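(* Let $H$ be an infinite-dimensional complex Hilbert space and let $A,B \in B(H)$ be non-scalar positive semi-definite contractions. Then $$\overline{W(AB)} \subseteq \overline{\mathrm{conv}\Big\{\bigcup_{\lambda \in \sigma(AB)} \mathcal{E}(\lambda)\Big\}}.$$ The closure signs (on both sides) can be removed if $\sigma(AB)$ is a discrete set. The set equality holds if $A, B$ are orthogonal projections.
   Context: $B(H)$ is the algebra of bounded linear operators on $H$. A contraction is an operator of norm at most $1$; non-scalar means not a scalar multiple of the identity; an orthogonal projection is an operator $P$ with $P^2=P=P^*$. $\sigma(X)$ is the spectrum and $W(X)=\{\langle Xx,x\rangle : x\in H,\ \|x\|=1\}$ the numerical range of $X$; $\mathrm{conv}$ denotes the convex hull and the bar denotes closure in $\mathbb{C}$. The paper uses "$\sigma(AB)$ is a discrete set" to mean that $\sigma(AB)$ is finite or countably infinite. For such $A,B$ one has $\sigma(AB)\subseteq[0,1]$. For $\lambda\in[0,1]$, $\mathcal{E}(\lambda)\subset\mathbb{C}$ is the (closed, possibly degenerate) elliptical disk with foci $0,\lambda$, minor axis with end points $(\lambda\pm i\sqrt{\lambda(1-\lambda)})/2$ and major axis with end points $(\lambda\pm\sqrt{\lambda})/2$; equivalently, $\mathcal{E}(\lambda)=W\left(\begin{pmatrix}\lambda & 0\\ \sqrt{\lambda(1-\lambda)} & 0\end{pmatrix}\right)$. *)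

theory Defs
  imports "HOL-Analysis.Analysis"
begin

class scaleC =
  fixes scaleC :: "complex \<Rightarrow> 'a \<Rightarrow> 'a"  (infixr "*\<^sub>C" 75)

class complex_vector = real_vector + scaleC +
  assumes scaleC_add_right: "a *\<^sub>C (x + y) = a *\<^sub>C x + a *\<^sub>C y"
    and scaleC_add_left: "(a + b) *\<^sub>C x = a *\<^sub>C x + b *\<^sub>C x"
    and scaleC_scaleC: "a *\<^sub>C (b *\<^sub>C x) = (a * b) *\<^sub>C x"
    and scaleR_scaleC: "r *\<^sub>R x = complex_of_real r *\<^sub>C x"

global_interpretation complex_vector:
  vector_space "scaleC :: complex \<Rightarrow> 'a \<Rightarrow> 'a::complex_vector"
  defines cspan = complex_vector.span
proof
  show "1 *\<^sub>C x = x" for x :: 'a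
    by (metis of_real_1 scaleR_one scaleR_scaleC)
qed (simp_all add: scaleC_add_right scaleC_add_left scaleC_scaleC)

(* The inner product is linear in the first argument. The norm, and with it the
   metric and the topology, is the one of the underlying real inner product space
   with inner product Re (cinner x y); hence norm x = sqrt (Re (cinner x x)). *)
class complex_inner = complex_vector + real_inner +
  fixes cinner :: "'a \<Rightarrow> 'a \<Rightarrow> complex"
  assumes cinner_commute: "cinner x y = cnj (cinner y x)"
    and cinner_add_left: "cinner (x + y) z = cinner x z + cinner y z"
    and cinner_scaleC_left: "cinner (c *\<^sub>C x) y = c * cinner x y"
    and inner_eq_Re_cinner: "inner x y = Re (cinner x y)"

class chilbert_space = complex_inner + complete_space

(* Membership in B(H). *)
definition bounded_clinear :: "('a::complex_inner \<Rightarrow> 'a) \<Rightarrow> bool" where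
  "bounded_clinear X \<longleftrightarrow> bounded_linear X \<and> (\<forall>c x. X (c *\<^sub>C x) = c *\<^sub>C X x)"

definition is_cadjoint :: "('a::complex_inner \<Rightarrow> 'a) \<Rightarrow> ('a \<Rightarrow> 'a) \<Rightarrow> bool" where
  "is_cadjoint X Y \<longleftrightarrow> (\<forall>x y. cinner (X x) y = cinner x (Y y))"

definition orthogonal_projection :: "('a::complex_inner \<Rightarrow> 'a) \<Rightarrow> bool" where
  "orthogonal_projection P \<longleftrightarrow> bounded_clinear P \<and> P \<circ> P = P \<and> is_cadjoint P P"

(* The quadratic form is real and nonnegative; over the complex numbers this
   includes self-adjointness. *)
definition positive_semidefinite :: "('a::complex_inner \<Rightarrow> 'a) \<Rightarrow> bool" where
  "positive_semidefinite X \<longleftrightarrow> bounded_clinear X \<and> (\<forall>x. cinner (X x) x \<in> \<real>\<^sub>\<ge>\<^sub>0)"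

definition contraction :: "('a::complex_inner \<Rightarrow> 'a) \<Rightarrow> bool" where
  "contraction X \<longleftrightarrow> bounded_clinear X \<and> onorm X \<le> 1"

definition scalar_operator :: "('a::complex_inner \<Rightarrow> 'a) \<Rightarrow> bool" where
  "scalar_operator X \<longleftrightarrow> (\<exists>c. X = (\<lambda>x. c *\<^sub>C x))"

definition invertible_operator :: "('a::complex_inner \<Rightarrow> 'a) \<Rightarrow> bool" where
  "invertible_operator X \<longleftrightarrow> (\<exists>Y. bounded_clinear Y \<and> X \<circ> Y = id \<and> Y \<circ> X = id)"

definition op_spectrum :: "('a::complex_inner \<Rightarrow> 'a) \<Rightarrow> complex set" where
  "op_spectrum X = {z. \<not> invertible_operator (\<lambda>x. X x - z *\<^sub>C x)}"

definition numerical_range :: "('a::complex_inner \<Rightarrow> 'a) \<Rightarrow> complex set" where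
  "numerical_range X = {cinner (X x) x | x. norm x = 1}"

(* The disk bounded by the ellipse with foci 0 and l and major axis of length sqrt l,
   whose ends are (l +- sqrt l)/2. The ends of the minor axis,
   (l +- i sqrt (l (1 - l)))/2, have modulus sqrt l / 2 and the same distance from l.
   For l = 0 it is {0}, for l = 1 it is the segment [0,1]. *)
definition elliptical_disk :: "real \<Rightarrow> complex set" where
  "elliptical_disk l = {z. cmod z + cmod (z - complex_of_real l) \<le> sqrt l}"

end

theory Submission
  imports Defs
begin

text \<open>
For a unit complex number \<open>e\<close> let \<open>disk_support e l\<close> be the maximum of \<open>Re (e * z)\<close> over the
elliptical disk with foci \<open>0\<close> and \<open>l\<close>. The disk is empty unless \<open>0 \<le> l \<le> 1\<close>, and the spectrum is
closed, so the union of the disks is compact and its convex hull is closed. By separation, the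
numerical range is contained in this hull if, for \<open>h \<ge> 0\<close>, the inequality
\<open>disk_support e l \<le> h\<close> for all spectral values \<open>l\<close> implies
\<open>Re (e * cinner (A (B x)) x) \<le> h * (norm x)\<^sup>2\<close> (\<open>product_quadratic_form_le\<close>).

The reason for this bound is a dilation. With \<open>V = (A^(1/2), (1 - A)^(1/2), 0)\<close> and
\<open>W = (B^(1/2), 0, (1 - B)^(1/2))\<close>, both isometries from \<open>H\<close> into \<open>H \<oplus> H \<oplus> H\<close>, the operators
\<open>P = V V*\<close> and \<open>Q = W W*\<close> are projections, \<open>A B\<close> is the compression of \<open>P Q\<close> to the first summand,
and \<open>P Q\<close> has the nonzero spectrum of \<open>A B\<close>. Let \<open>N\<close> be the real part of \<open>e P Q\<close>. If \<open>N z = m z\<close>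
with \<open>m > 0\<close>, eliminating \<open>W* z\<close> from the equations for \<open>V* z\<close> and \<open>W* z\<close> shows that
\<open>X\<^sup>2 - (4 m Re e + 1) X + 4 m\<^sup>2\<close> annihilates a nonzero vector for \<open>X = A B\<close>, so a root \<open>l\<close> of this
quadratic is a spectral value. But the quadratic is positive at \<open>l\<close> as soon as \<open>m\<close> exceeds
\<open>disk_support e l\<close>: its vanishing means that the line at height \<open>m\<close> in direction \<open>e\<close> has distances
from the foci whose product is the square of the minor semi-axis, which characterizes the tangents.
Hence \<open>N \<le> h\<close>.

The square roots do not enter the formal argument: on the vectors
\<open>(x, 0, 0) + V A^(1/2) a + W B^(1/2) b\<close> the squared norm and the form of \<open>N\<close> are polynomial in \<open>A\<close> and \<open>B\<close> (\<open>dilation_form\<close>,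
\<open>dilation_product\<close>). As the supremum of the form need not be attained there, the eigenvector
equation is replaced by an estimate of the gradient (\<open>dilation_gradient_bound\<close>), and the spectral
condition by \<open>A B - r\<close> being bounded below (\<open>product_minus_scalar_bounded_below\<close>).

For orthogonal projections \<open>P\<close>, \<open>Q\<close> and a spectral value \<open>l \<noteq> 0\<close> of \<open>P Q\<close> there are unit vectors \<open>p\<close>
in the range of \<open>P\<close> with \<open>P Q p\<close> close to \<open>l p\<close>. On the span of \<open>p\<close> and \<open>Q p\<close> the compression of
\<open>P Q\<close> is then close to the two-dimensional operator whose numerical range is the elliptical disk, so the
numerical range reaches \<open>disk_support e l\<close> in every direction \<open>e\<close>; by the Toeplitz-Hausdorff
theorem its closure contains the disk.
\<close>

section \<open>Complex inner products and bounded operators\<close>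

lemma cinner_add_right: "cinner x (y + z) = cinner x y + cinner x z"
  by (metis cinner_commute cinner_add_left complex_cnj_add)

lemma cinner_scaleC_right: "cinner x (c *\<^sub>C y) = cnj c * cinner x y"
  by (metis cinner_commute cinner_scaleC_left complex_cnj_mult)

lemma cinner_minus_left: "cinner (- x) y = - cinner x y"
  using cinner_scaleC_left[of "-1" x y] by simp

lemma cinner_minus_right: "cinner x (- y) = - cinner x y"
  using cinner_scaleC_right[of x "-1" y] by simp

lemma cinner_diff_left: "cinner (x - y) z = cinner x z - cinner y z"
  using cinner_add_left[of x "- y" z] by (simp add: cinner_minus_left)

lemma cinner_diff_right: "cinner x (y - z) = cinner x y - cinner x z"
  using cinner_add_right[of x y "- z"] by (simp add: cinner_minus_right)

lemma cinner_zero_right [simp]: "cinner x 0 = 0"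
  using cinner_diff_right[of x 0 0] by simp

lemmas cinner_simps = cinner_add_left cinner_add_right cinner_diff_left cinner_diff_right
  cinner_scaleC_left cinner_scaleC_right

lemma cinner_self: "cinner x x = complex_of_real ((norm x)\<^sup>2)"
  using cinner_commute[of x x] inner_eq_Re_cinner[of x x]
  by (simp add: complex_eq_iff power2_norm_eq_inner)

lemma norm_scaleC: "norm (c *\<^sub>C x) = cmod c * norm (x :: 'a::complex_inner)"
proof -
  have "complex_of_real ((norm (c *\<^sub>C x))\<^sup>2) = c * cnj c * complex_of_real ((norm x)\<^sup>2)"
    unfolding cinner_self[symmetric] by (simp add: cinner_simps)
  also have "\<dots> = complex_of_real ((cmod c * norm x)\<^sup>2)"
    by (simp add: power_mult_distrib complex_norm_square[symmetric])
  finally have "(norm (c *\<^sub>C x))\<^sup>2 = (cmod c * norm x)\<^sup>2"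
    using of_real_eq_iff by blast
  then show ?thesis by simp
qed

lemma inner_scaleC_left: "inner (c *\<^sub>C x) y = inner x (cnj c *\<^sub>C (y :: 'a::complex_inner))"
  by (simp add: inner_eq_Re_cinner cinner_simps)

text \<open>The real Cauchy-Schwarz inequality, after a rotation that makes the complex inner product real.\<close>

lemma cmod_cinner_le: "cmod (cinner x y) \<le> norm x * norm y"
proof (cases "cinner x y = 0")
  case False
  define w where "w = cnj (sgn (cinner x y))"
  have w: "cmod w = 1" using False by (simp add: w_def norm_sgn)
  have "w * cinner x y = complex_of_real (cmod (cinner x y))"
    using False by (simp add: w_def sgn_eq complex_norm_square[symmetric] power2_eq_square field_simps)
  then have "cmod (cinner x y) = inner (w *\<^sub>C x) y"
    by (simp add: inner_eq_Re_cinner cinner_simps)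
  also have "\<dots> \<le> norm (w *\<^sub>C x) * norm y" by (rule norm_cauchy_schwarz)
  finally show ?thesis by (simp add: norm_scaleC w)
qed simp

lemma bounded_linear_scaleC: "bounded_linear (\<lambda>x. c *\<^sub>C (x :: 'a::complex_inner))"
  by (rule bounded_linear_intro[where K = "cmod c"])
    (simp_all add: scaleC_add_right scaleR_scaleC scaleC_scaleC norm_scaleC mult.commute)

lemma bounded_clinear_simps:
  assumes "bounded_clinear X"
  shows "X (x + y) = X x + X y" "X (x - y) = X x - X y" "X (- x) = - X x" "X 0 = 0"
    "X (c *\<^sub>C x) = c *\<^sub>C X x" "X (r *\<^sub>R x) = r *\<^sub>R X x"
proof -
  have l: "linear X" using assms by (simp add: bounded_clinear_def bounded_linear.linear)
  show "X (x + y) = X x + X y" "X (x - y) = X x - X y" "X (- x) = - X x" "X 0 = 0"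
    "X (r *\<^sub>R x) = r *\<^sub>R X x"
    using l by (rule linear_add linear_diff linear_neg linear_0 linear_scale)+
  show "X (c *\<^sub>C x) = c *\<^sub>C X x" using assms by (simp add: bounded_clinear_def)
qed

lemma bounded_clinear_comp:
  "bounded_clinear X \<Longrightarrow> bounded_clinear Y \<Longrightarrow> bounded_clinear (\<lambda>x. X (Y x))"
  unfolding bounded_clinear_def by (auto intro: bounded_linear_compose)

lemma bounded_clinear_diff_scaleC:
  "bounded_clinear X \<Longrightarrow> bounded_clinear (\<lambda>x. X x - z *\<^sub>C x)"
  unfolding bounded_clinear_def
  by (auto intro!: bounded_linear_sub bounded_linear_scaleC
      simp: scaleC_scaleC complex_vector.scale_right_diff_distrib mult.commute)

definition bounded_below :: "('a::real_normed_vector \<Rightarrow> 'a) \<Rightarrow> bool" where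
  "bounded_below X \<longleftrightarrow> (\<exists>c>0. \<forall>x. c * norm x \<le> norm (X x))"

lemma invertible_imp_bounded_below:
  assumes "invertible_operator X"
  shows "bounded_below X"
proof -
  obtain Y where Y: "bounded_clinear Y" "Y \<circ> X = id"
    using assms unfolding invertible_operator_def by blast
  obtain K where K: "K > 0" "\<And>x. norm (Y x) \<le> norm x * K"
    using bounded_linear.pos_bounded[of Y] Y(1) unfolding bounded_clinear_def by blast
  have "inverse K * norm x \<le> norm (X x)" for x
    using K(2)[of "X x"] K(1) fun_cong[OF Y(2), of x] by (simp add: field_simps)
  then show ?thesis using K(1) unfolding bounded_below_def by (meson positive_imp_inverse_positive)
qed

lemma invertible_if_bounded_below_surj:
  assumes X: "bounded_clinear X" and b: "bounded_below X" and s: "surj X"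
  shows "invertible_operator X"
proof -
  obtain c where c: "c > 0" "\<And>x. c * norm x \<le> norm (X x)"
    using b unfolding bounded_below_def by blast
  have inj: "x = y" if "X x = X y" for x y
    using c(2)[of "x - y"] c(1) that by (simp add: bounded_clinear_simps[OF X] mult_le_0_iff)
  have XY: "X (inv X y) = y" for y using s by (rule surj_f_inv_f)
  have YX: "inv X (X x) = x" for x using inj[OF XY] .
  have "bounded_linear (inv X)"
  proof (rule bounded_linear_intro[where K = "1 / c"])
    show "inv X (x + y) = inv X x + inv X y" for x y
      by (rule inj) (simp add: XY bounded_clinear_simps[OF X])
    show "inv X (r *\<^sub>R x) = r *\<^sub>R inv X x" for r x
      by (rule inj) (simp add: XY bounded_clinear_simps[OF X])
    show "norm (inv X x) \<le> norm x * (1 / c)" for x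
      using c(2)[of "inv X x"] c(1) by (simp add: XY field_simps)
  qed
  moreover have "inv X (a *\<^sub>C x) = a *\<^sub>C inv X x" for a x
    by (rule inj) (simp add: XY bounded_clinear_simps[OF X])
  ultimately show ?thesis
    unfolding invertible_operator_def bounded_clinear_def using XY YX
    by (intro exI[of _ "inv X"]) auto
qed

text \<open>If \<open>Y X\<close> is within distance \<open>q < 1\<close> of the identity, then \<open>y \<mapsto> y - Y (X y - v)\<close> is a contraction of a
complete space, and its fixed point solves \<open>X y = v\<close> because \<open>Y\<close> is injective.\<close>

lemma surj_if_approx_left_inverse:
  fixes X Y :: "'a::{real_normed_vector, complete_space} \<Rightarrow> 'a"
  assumes X: "linear X" and Y: "linear Y" "inj Y"
    and q: "q < 1" "\<And>y. norm (y - Y (X y)) \<le> q * norm y"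
  shows "surj X"
proof -
  have "\<exists>y. X y = v" for v
  proof -
    define f where "f y = y - Y (X y - v)" for y
    have "dist (f y) (f z) \<le> max q 0 * dist y z" for y z
    proof -
      have "f y - f z = (y - z) - Y (X (y - z))"
        by (simp add: f_def linear_diff[OF X] linear_diff[OF Y(1)])
      then have "dist (f y) (f z) \<le> q * dist y z" using q(2)[of "y - z"] by (simp add: dist_norm)
      also have "\<dots> \<le> max q 0 * dist y z" by (intro mult_right_mono) auto
      finally show ?thesis .
    qed
    then have "\<exists>!y. f y = y" using q by (intro banach_fix_type[of "max q 0"]) auto
    then obtain y where "f y = y" by blast
    then have "Y (X y - v) = Y 0" by (simp add: f_def linear_0[OF Y(1)])
    then have "X y = v" using Y(2) by (simp add: inj_eq)
    then show ?thesis by blast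
  qed
  then show ?thesis unfolding surj_def by metis
qed

lemma invertible_perturb:
  fixes X :: "'a::chilbert_space \<Rightarrow> 'a"
  assumes X: "bounded_clinear X" "invertible_operator X"
  obtains e where "e > 0" "\<And>w. cmod w < e \<Longrightarrow> invertible_operator (\<lambda>x. X x - w *\<^sub>C x)"
proof -
  obtain Y where Y: "bounded_clinear Y" "X \<circ> Y = id" "Y \<circ> X = id"
    using X(2) unfolding invertible_operator_def by blast
  have XY: "X (Y y) = y" "Y (X y) = y" for y
    using Y(2,3) by (metis comp_apply id_apply)+
  obtain K where K: "K > 0" "\<And>x. norm (Y x) \<le> norm x * K"
    using bounded_linear.pos_bounded[of Y] Y(1) unfolding bounded_clinear_def by blast
  have "invertible_operator (\<lambda>x. X x - w *\<^sub>C x)" (is "invertible_operator ?Z")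
    if w: "cmod w < 1 / K" for w
  proof (rule invertible_if_bounded_below_surj)
    show Z: "bounded_clinear ?Z" by (rule bounded_clinear_diff_scaleC[OF X(1)])
    have wK: "cmod w * K < 1" using w K(1) by (simp add: field_simps)
    have est: "norm (y - Y (?Z y)) \<le> (cmod w * K) * norm y" for y
      using K(2)[of "w *\<^sub>C y"] by (simp add: bounded_clinear_simps[OF Y(1)] XY norm_scaleC mult_ac)
    show "surj ?Z"
    proof (rule surj_if_approx_left_inverse[where Y = Y and q = "cmod w * K"])
      show "linear ?Z" "linear Y"
        using Z Y(1) unfolding bounded_clinear_def by (auto intro: bounded_linear.linear)
      show "inj Y" using XY(1) by (rule inj_on_inverseI)
      show "cmod w * K < 1" by (rule wK)
      show "norm (y - Y (?Z y)) \<le> cmod w * K * norm y" for y by (rule est)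
    qed
    have "(1 - cmod w * K) / K * norm y \<le> norm (?Z y)" for y
    proof -
      have "norm y \<le> norm (Y (?Z y)) + norm (y - Y (?Z y))" using norm_triangle_ineq[of "Y (?Z y)" "y - Y (?Z y)"] by simp
      also have "\<dots> \<le> norm (?Z y) * K + (cmod w * K) * norm y" by (intro add_mono K(2) est)
      finally have "(1 - cmod w * K) * norm y \<le> norm (?Z y) * K" by (simp add: left_diff_distrib)
      then show ?thesis using K(1) by (simp add: pos_divide_le_eq)
    qed
    moreover have "(1 - cmod w * K) / K > 0" using wK K(1) by simp
    ultimately show "bounded_below ?Z" unfolding bounded_below_def by blast
  qed
  then show ?thesis using K(1) by (intro that[of "1 / K"]) auto
qed

lemma closed_real_spectrum:
  fixes X :: "'a::chilbert_space \<Rightarrow> 'a"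
  assumes X: "bounded_clinear X"
  shows "closed {l. complex_of_real l \<in> op_spectrum X}"
proof -
  have "open (- {l. complex_of_real l \<in> op_spectrum X})"
    unfolding open_dist
  proof
    fix l assume "l \<in> - {l. complex_of_real l \<in> op_spectrum X}"
    then have "invertible_operator (\<lambda>x. X x - complex_of_real l *\<^sub>C x)" by (simp add: op_spectrum_def)
    from invertible_perturb[OF bounded_clinear_diff_scaleC[OF X] this]
    obtain e where e: "e > 0"
      "\<And>w. cmod w < e \<Longrightarrow> invertible_operator (\<lambda>x. X x - complex_of_real l *\<^sub>C x - w *\<^sub>C x)" by blast
    have "invertible_operator (\<lambda>x. X x - complex_of_real k *\<^sub>C x)" if "dist k l < e" for k
    proof -
      have "cmod (complex_of_real (k - l)) < e" using that by (simp only: norm_of_real dist_real_def)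
      moreover have "X x - complex_of_real l *\<^sub>C x - complex_of_real (k - l) *\<^sub>C x = X x - complex_of_real k *\<^sub>C x" for x
        by (simp add: complex_vector.scale_left_diff_distrib)
      ultimately show ?thesis using e(2)[of "complex_of_real (k - l)"] by (simp only:)
    qed
    then show "\<exists>e>0. \<forall>k. dist k l < e \<longrightarrow> k \<in> - {l. complex_of_real l \<in> op_spectrum X}"
      using e(1) by (auto simp: op_spectrum_def)
  qed
  then show ?thesis by (simp add: closed_def)
qed

section \<open>Supporting lines of the elliptical disk\<close>

text \<open>The disk has centre \<open>l / 2\<close> and semi-axes \<open>sqrt l / 2\<close> and \<open>sqrt (l * (1 - l)) / 2\<close>. For \<open>cmod e = 1\<close>
and \<open>0 \<le> l \<le> 1\<close> the usual formula for the support function of an ellipse simplifies to this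
expression.\<close>

definition disk_support :: "complex \<Rightarrow> real \<Rightarrow> real" where
  "disk_support e l = (Re e * l + sqrt (l - (Im e)\<^sup>2 * l\<^sup>2)) / 2"

text \<open>The foci are at distance \<open>\<bar>l\<bar>\<close>, so a point of the disk forces \<open>\<bar>l\<bar> \<le> sqrt l\<close>. (For negative \<open>l\<close> the
square root is negative.)\<close>

lemma elliptical_disk_bounds:
  assumes "z \<in> elliptical_disk l"
  shows "0 \<le> l" "l \<le> 1"
proof -
  have le: "cmod z + cmod (z - complex_of_real l) \<le> sqrt l"
    using assms by (simp add: elliptical_disk_def)
  have "\<bar>l\<bar> \<le> cmod z + cmod (z - complex_of_real l)"
    using norm_triangle_ineq4[of z "z - complex_of_real l"] by simp
  with le have *: "\<bar>l\<bar> \<le> sqrt l" by linarith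
  then show l: "0 \<le> l" by (metis abs_ge_zero order_trans real_sqrt_ge_0_iff)
  show "l \<le> 1"
  proof (cases "l = 0")
    case False
    have "sqrt l * sqrt l \<le> 1 * sqrt l" using * l by simp
    then have "sqrt l \<le> 1" using False l by (subst (asm) mult_le_cancel_right) auto
    then show ?thesis by simp
  qed simp
qed

text \<open>The union is the projection to the second factor of a closed bounded subset of the pairs \<open>(l, z)\<close>.\<close>

lemma compact_Union_elliptical_disk:
  assumes "closed S"
  shows "compact (\<Union>l\<in>S. elliptical_disk l)"
proof -
  let ?G = "{p :: real \<times> complex. fst p \<in> S \<and> cmod (snd p) + cmod (snd p - complex_of_real (fst p)) \<le> sqrt (fst p)}"
  have "closed (fst -` S \<inter> {p :: real \<times> complex. cmod (snd p) + cmod (snd p - complex_of_real (fst p)) \<le> sqrt (fst p)})"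
    by (intro closed_Int continuous_closed_vimage assms closed_Collect_le continuous_intros)
  moreover have "fst -` S \<inter> {p :: real \<times> complex. cmod (snd p) + cmod (snd p - complex_of_real (fst p)) \<le> sqrt (fst p)} = ?G"
    by auto
  ultimately have "closed ?G" by simp
  moreover have "?G \<subseteq> {0..1} \<times> cball 0 1"
  proof clarify
    fix l z assume "cmod (snd (l, z)) + cmod (snd (l, z) - complex_of_real (fst (l, z))) \<le> sqrt (fst (l, z))"
    then have le: "cmod z + cmod (z - complex_of_real l) \<le> sqrt l" by simp
    then have l: "0 \<le> l" "l \<le> 1" using elliptical_disk_bounds[of z l] by (simp_all add: elliptical_disk_def)
    moreover have "cmod z \<le> 1" using le l real_sqrt_le_1_iff[of l] norm_ge_zero[of "z - complex_of_real l"] by linarith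
    ultimately show "l \<in> {0..1} \<and> z \<in> cball 0 1" by simp
  qed
  moreover have "compact ({0..1::real} \<times> cball (0::complex) 1)" by (intro compact_Times) auto
  ultimately have "compact ?G" using compact_Int_closed[of "{0..1} \<times> cball 0 1" ?G] by (simp only: inf.absorb2)
  then have "compact (snd ` ?G)" by (intro compact_continuous_image continuous_intros)
  moreover have "snd ` ?G = (\<Union>l\<in>S. elliptical_disk l)" by (auto simp: elliptical_disk_def image_iff intro: rev_bexI)
  ultimately show ?thesis by simp
qed

lemma unit_Re_Im: "cmod e = 1 \<Longrightarrow> (Re e)\<^sup>2 + (Im e)\<^sup>2 = 1"
  by (metis cmod_power2 power_one)

lemma disk_support_discriminant:
  assumes "cmod e = 1" "0 \<le> l" "l \<le> 1"
  shows "l - (Im e)\<^sup>2 * l\<^sup>2 = l * (1 - l) + (Re e * l)\<^sup>2" "0 \<le> l - (Im e)\<^sup>2 * l\<^sup>2"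
proof -
  have "l - (Im e)\<^sup>2 * l\<^sup>2 - (l * (1 - l) + (Re e * l)\<^sup>2) = l\<^sup>2 * (1 - ((Re e)\<^sup>2 + (Im e)\<^sup>2))"
    by (simp add: algebra_simps power2_eq_square)
  then show eq: "l - (Im e)\<^sup>2 * l\<^sup>2 = l * (1 - l) + (Re e * l)\<^sup>2"
    using unit_Re_Im[OF assms(1)] by simp
  show "0 \<le> l - (Im e)\<^sup>2 * l\<^sup>2" unfolding eq using assms by simp
qed

text \<open>The sum of the distances to the foci is bounded below by reflecting one focal vector: conjugating
\<open>e * (z - l)\<close> and adding \<open>e * z\<close> gives a number \<open>D\<close> whose imaginary part \<open>Im e * l\<close> does not depend
on \<open>z\<close>, so \<open>cmod D \<le> sqrt l\<close> bounds its real part, which determines \<open>Re (e * z)\<close>.\<close>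

lemma Re_le_disk_support:
  assumes e: "cmod e = 1" and z: "z \<in> elliptical_disk l"
  shows "Re (e * z) \<le> disk_support e l"
proof -
  note l = elliptical_disk_bounds[OF z]
  define D where "D = e * z + cnj (e * (z - complex_of_real l))"
  have "cmod D \<le> cmod z + cmod (z - complex_of_real l)"
    unfolding D_def using norm_triangle_ineq[of "e * z" "cnj (e * (z - complex_of_real l))"] e
    by (simp only: complex_mod_cnj norm_mult)
  then have "cmod D \<le> sqrt l" using z by (simp add: elliptical_disk_def)
  then have "(cmod D)\<^sup>2 \<le> l" using l by (metis norm_ge_zero power_mono real_sqrt_pow2)
  moreover have "Re D = 2 * Re (e * z) - Re e * l" "Im D = Im e * l"
    by (simp_all add: D_def algebra_simps)
  ultimately have "(2 * Re (e * z) - Re e * l)\<^sup>2 \<le> l - (Im e)\<^sup>2 * l\<^sup>2"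
    by (simp add: cmod_power2 power_mult_distrib)
  then have "2 * Re (e * z) - Re e * l \<le> sqrt (l - (Im e)\<^sup>2 * l\<^sup>2)"
    by (rule real_le_rsqrt)
  then show ?thesis by (simp add: disk_support_def)
qed

text \<open>The extremal point is the case of equality in the triangle inequality used for
\<open>Re_le_disk_support\<close>: the vectors \<open>e * z\<close> and \<open>cnj (e * (z - l))\<close> are the parts \<open>k * D\<close> and
\<open>(1 - k) * D\<close> of one vector \<open>D\<close> of length \<open>sqrt l\<close>.\<close>

lemma disk_support_attained:
  assumes e: "cmod e = 1" and l: "0 \<le> l" "l \<le> 1"
  obtains z where "z \<in> elliptical_disk l" "Re (e * z) = disk_support e l"
proof -
  define R where "R = sqrt (l - (Im e)\<^sup>2 * l\<^sup>2)"
  define t where "t = disk_support e l"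
  have t: "2 * t = R + Re e * l" by (simp add: t_def disk_support_def R_def)
  note disc = disk_support_discriminant[OF e l]
  have R2: "R\<^sup>2 = l * (1 - l) + (Re e * l)\<^sup>2" using disc by (simp add: R_def)
  have Rl: "R\<^sup>2 + (Im e * l)\<^sup>2 = l" using disc(2) by (simp add: R_def power_mult_distrib)
  have R0: "R \<ge> 0" using disc by (simp add: R_def)
  have "(Re e * l)\<^sup>2 \<le> R\<^sup>2" using R2 l by simp
  then have abs: "\<bar>Re e * l\<bar> \<le> R" using R0 by (metis abs_le_square_iff abs_of_nonneg)
  show ?thesis
  proof (cases "R = 0")
    case True
    have "0 \<le> l * (1 - l)" using l by simp
    then have "l * (1 - l) = 0"
      using R2 add_nonneg_eq_0_iff[of "l * (1 - l)" "(Re e * l)\<^sup>2"] unfolding True by auto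
    then have "0 \<in> elliptical_disk l" using l by (auto simp: elliptical_disk_def)
    moreover have "t = 0" using t abs True by auto
    ultimately show ?thesis using that[of 0] by (simp add: t_def)
  next
    case False
    then have R: "R > 0" using R0 by simp
    \<comment> \<open>the only division of \<open>D\<close> for which the two parts come from the same point \<open>z\<close>\<close>
    define k where "k = t / R"
    have tb: "0 \<le> t" "t \<le> R" using t abs by linarith+
    have k: "0 \<le> k" "k \<le> 1" unfolding k_def using tb R by (simp_all add: divide_le_eq)
    have kR: "k * R = t" using R by (simp add: k_def)
    define D where "D = Complex R (Im e * l)"
    have cD: "cmod D = sqrt l" using Rl by (simp add: D_def cmod_def)
    define z where "z = cnj e * (complex_of_real k * D)"
    have ee: "e * cnj e = 1" using e by (simp add: complex_norm_square[symmetric])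
    have ez: "e * z = complex_of_real k * D"
      using ee by (simp add: z_def mult.assoc[symmetric])
    have "e * (z - complex_of_real l) = complex_of_real (1 - k) * cnj D"
    proof (rule complex_eqI)
      show "Re (e * (z - complex_of_real l)) = Re (complex_of_real (1 - k) * cnj D)"
        unfolding right_diff_distrib ez using kR t by (simp add: D_def algebra_simps)
      show "Im (e * (z - complex_of_real l)) = Im (complex_of_real (1 - k) * cnj D)"
        unfolding right_diff_distrib ez by (simp add: D_def algebra_simps)
    qed
    then have "cmod (e * (z - complex_of_real l)) = (1 - k) * cmod D"
      using k by (simp only: norm_mult complex_mod_cnj norm_of_real abs_of_nonneg)
    then have n2: "cmod (z - complex_of_real l) = (1 - k) * sqrt l"
      using e cD by (simp add: norm_mult)
    have "cmod (e * z) = k * cmod D" using k by (simp add: ez norm_mult)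
    then have "cmod z = k * sqrt l" using e cD by (simp add: norm_mult)
    with n2 have "z \<in> elliptical_disk l" by (simp add: elliptical_disk_def algebra_simps)
    moreover have "Re (e * z) = disk_support e l" using kR by (simp add: ez D_def t_def)
    ultimately show ?thesis using that by blast
  qed
qed

text \<open>A supporting line has distances \<open>t\<close> and \<open>t - l * Re e\<close> from the foci, and their product is the square
\<open>l * (1 - l) / 4\<close> of the minor semi-axis.\<close>

lemma disk_support_quadratic:
  assumes e: "cmod e = 1" and l: "0 \<le> l" "l \<le> 1" and t: "t = disk_support e l"
  shows "4 * t\<^sup>2 - 4 * t * l * Re e = l - l\<^sup>2"
proof -
  define R where "R = sqrt (l - (Im e)\<^sup>2 * l\<^sup>2)"
  have "R\<^sup>2 = l * (1 - l) + (Re e * l)\<^sup>2" using disk_support_discriminant[OF e l] by (simp add: R_def)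
  moreover have "2 * t = R + Re e * l" by (simp add: t disk_support_def R_def)
  then have "R = 2 * t - Re e * l" by simp
  ultimately show ?thesis by (simp add: power2_eq_square algebra_simps)
qed

text \<open>As a polynomial in \<open>m\<close>, the right-hand side has \<open>disk_support e l\<close> as its larger root. It is written
as a polynomial in \<open>l\<close> because in the proof of the bound it is evaluated at the product of the two operators.\<close>

lemma quadratic_pos_above_disk_support:
  assumes e: "cmod e = 1" and l: "0 \<le> l" "l \<le> 1" and m: "disk_support e l < m"
  shows "0 < l\<^sup>2 - (4 * m * Re e + 1) * l + 4 * m\<^sup>2"
proof -
  define R where "R = sqrt (l - (Im e)\<^sup>2 * l\<^sup>2)"
  note disc = disk_support_discriminant[OF e l]
  have R2: "R\<^sup>2 = l * (1 - l) + (Re e * l)\<^sup>2" "0 \<le> R" using disc by (simp_all add: R_def)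
  have "R < 2 * m - Re e * l" using m by (simp add: disk_support_def R_def)
  then have "R\<^sup>2 < (2 * m - Re e * l)\<^sup>2" using R2(2) by (intro power_strict_mono) auto
  then show ?thesis using R2(1) by (simp add: power2_eq_square algebra_simps)
qed

section \<open>Positive contractions\<close>

text \<open>Polarization, which determines a complex sesquilinear form from its quadratic form.\<close>

lemma sesquilinear_zero_if_diagonal_zero:
  fixes s :: "'a::complex_vector \<Rightarrow> 'a \<Rightarrow> complex"
  assumes add: "\<And>x y z. s (x + y) z = s x z + s y z" "\<And>x y z. s x (y + z) = s x y + s x z"
    and scale: "\<And>c x y. s (c *\<^sub>C x) y = c * s x y" "\<And>c x y. s x (c *\<^sub>C y) = cnj c * s x y"
    and diag: "\<And>x. s x x = 0"
  shows "s x y = 0"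
proof -
  have "s x y + s y x = 0" using diag[of "x + y"] unfolding add by (simp add: diag add.commute)
  moreover have "\<i> * s y x - \<i> * s x y = 0"
    using diag[of "x + \<i> *\<^sub>C y"] unfolding add scale by (simp add: diag)
  then have "s y x = s x y" by simp
  ultimately show ?thesis by simp
qed

lemma zero_if_quadratic_form_zero:
  assumes T: "bounded_clinear T" and "\<And>x. cinner (T x) x = 0"
  shows "T x = 0"
proof -
  have "cinner (T x) y = 0" for x y
    by (rule sesquilinear_zero_if_diagonal_zero[of "\<lambda>x y. cinner (T x) y"])
      (simp_all add: assms(2) bounded_clinear_simps[OF T] cinner_simps)
  then have "cinner (T x) (T x) = 0" .
  then show ?thesis by (simp add: cinner_self)
qed

lemma positive_semidefinite_selfadjoint:
  assumes "positive_semidefinite X"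
  shows "cinner (X x) y = cinner x (X y)"
proof -
  have X: "bounded_clinear X" using assms by (simp add: positive_semidefinite_def)
  have "cinner (X x) x - cinner x (X x) = 0" for x
    using assms cinner_commute[of x "X x"]
    by (simp add: positive_semidefinite_def complex_nonneg_Reals_iff complex_eq_iff)
  note diag = this
  have "cinner (X x) y - cinner x (X y) = 0"
    by (rule sesquilinear_zero_if_diagonal_zero[of "\<lambda>x y. cinner (X x) y - cinner x (X y)", OF _ _ _ _ diag])
      (simp_all add: bounded_clinear_simps[OF X] cinner_simps right_diff_distrib)
  then show ?thesis by simp
qed

definition positive_contraction :: "('a::complex_inner \<Rightarrow> 'a) \<Rightarrow> bool" where
  "positive_contraction X \<longleftrightarrow> positive_semidefinite X \<and> contraction X"

text \<open>This is the operator inequality \<open>S\<^sup>2 \<le> S\<close> for \<open>0 \<le> S \<le> 1\<close>; it follows from the form being nonnegative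
at \<open>x - S x\<close>.\<close>

lemma norm_sq_le_quadratic_form:
  fixes S :: "'a::real_inner \<Rightarrow> 'a"
  assumes S: "linear S" and sym: "\<And>x y. inner (S x) y = inner x (S y)"
    and nonneg: "\<And>x. 0 \<le> inner (S x) x" and le: "\<And>x. inner (S x) x \<le> (norm x)\<^sup>2"
  shows "(norm (S x))\<^sup>2 \<le> inner (S x) x"
proof -
  have "0 \<le> inner (S (x - S x)) (x - S x)" by (rule nonneg)
  also have "\<dots> = inner (S x) x - 2 * (norm (S x))\<^sup>2 + inner (S (S x)) (S x)"
    using sym[of "S x" x]
    by (simp add: linear_diff[OF S] inner_diff_left inner_diff_right power2_norm_eq_inner)
  finally show ?thesis using le[of "S x"] by simp
qed

context
  fixes X :: "'a::complex_inner \<Rightarrow> 'a"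
  assumes X: "positive_contraction X"
begin

lemma positive_contraction_bounded_clinear: "bounded_clinear X"
  using X by (simp add: positive_contraction_def positive_semidefinite_def)

lemmas positive_contraction_simps = bounded_clinear_simps[OF positive_contraction_bounded_clinear]

lemma positive_contraction_linear: "linear X"
  using positive_contraction_bounded_clinear by (simp add: bounded_clinear_def bounded_linear.linear)

lemma positive_contraction_cinner: "cinner (X x) y = cinner x (X y)"
  using X by (intro positive_semidefinite_selfadjoint) (simp add: positive_contraction_def)

lemma positive_contraction_inner: "inner (X x) y = inner x (X y)"
  by (simp add: inner_eq_Re_cinner positive_contraction_cinner)

lemma positive_contraction_cinner_self: "cinner (X x) x = complex_of_real (inner (X x) x)"
  using X by (simp add: positive_contraction_def positive_semidefinite_def complex_nonneg_Reals_iff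
      inner_eq_Re_cinner complex_eq_iff)

lemma positive_contraction_nonneg: "0 \<le> inner (X x) x"
  using X by (simp add: positive_contraction_def positive_semidefinite_def complex_nonneg_Reals_iff
      inner_eq_Re_cinner)

lemma positive_contraction_norm_le: "norm (X x) \<le> norm x"
proof -
  have "norm (X x) \<le> onorm X * norm x"
    using positive_contraction_bounded_clinear by (intro onorm) (simp add: bounded_clinear_def)
  also have "\<dots> \<le> 1 * norm x"
    using X by (intro mult_right_mono) (auto simp: positive_contraction_def contraction_def)
  finally show ?thesis by simp
qed

lemma positive_contraction_inner_le: "inner (X x) x \<le> (norm x)\<^sup>2"
  using norm_cauchy_schwarz[of "X x" x] mult_right_mono[OF positive_contraction_norm_le[of x] norm_ge_zero[of x]]
  by (simp add: power2_eq_square)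

lemma positive_contraction_norm_sq_le: "(norm (X x))\<^sup>2 \<le> inner (X x) x"
  by (rule norm_sq_le_quadratic_form[OF positive_contraction_linear positive_contraction_inner
      positive_contraction_nonneg positive_contraction_inner_le])

text \<open>The same inequality for \<open>X - X\<^sup>2\<close>, which is again a positive contraction.\<close>

lemma positive_contraction_defect: "(norm (X x - X (X x)))\<^sup>2 \<le> inner (X x) x - (norm (X x))\<^sup>2"
proof -
  let ?S = "\<lambda>x. X x - X (X x)"
  have S: "inner (?S x) x = inner (X x) x - (norm (X x))\<^sup>2" for x
    using positive_contraction_inner[of "X x" x] by (simp add: inner_diff_left power2_norm_eq_inner)
  have "(norm (?S x))\<^sup>2 \<le> inner (?S x) x"
  proof (rule norm_sq_le_quadratic_form)
    show "linear ?S"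
      by (rule linearI) (simp_all add: positive_contraction_simps scaleR_diff_right)
    show "inner (?S x) y = inner x (?S y)" for x y
      by (simp add: inner_diff_left inner_diff_right positive_contraction_inner)
    show "0 \<le> inner (?S x) x" for x unfolding S using positive_contraction_norm_sq_le[of x] by simp
    show "inner (?S x) x \<le> (norm x)\<^sup>2" for x unfolding S using positive_contraction_inner_le[of x] by (simp add: add_increasing2 diff_le_eq)
  qed
  then show ?thesis by (simp add: S)
qed

end

text \<open>An approximate eigenvalue \<open>r \<noteq> 0\<close> of \<open>A B\<close> has to be a real number in the unit interval. It is bounded
by the norm of the product. If \<open>r\<close> is not a nonnegative real number, take the inner product of
\<open>(A B - r) y\<close> with \<open>B y\<close>: it is \<open>w - r b\<close> with \<open>w \<ge> 0\<close> and \<open>b = inner (B y) y \<ge> 0\<close>, so a small value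
forces \<open>b\<close>, hence \<open>B y\<close>, \<open>A (B y)\<close> and finally \<open>r y\<close> to be small.\<close>

lemma product_minus_scalar_bounded_below:
  assumes A: "positive_contraction A" and B: "positive_contraction B" and r: "r \<noteq> 0"
    and not: "\<And>l. 0 \<le> l \<Longrightarrow> l \<le> 1 \<Longrightarrow> complex_of_real l \<in> op_spectrum (A \<circ> B) \<Longrightarrow> r \<noteq> complex_of_real l"
  shows "bounded_below (\<lambda>y. A (B y) - r *\<^sub>C y)"
proof (cases "r \<in> op_spectrum (A \<circ> B)")
  case False
  then show ?thesis
    by (intro invertible_imp_bounded_below) (simp add: op_spectrum_def o_def)
next
  case True
  note nA = positive_contraction_norm_le[OF A] and nB = positive_contraction_norm_le[OF B]
  show ?thesis
  proof (cases "cmod r > 1")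
    case big: True
    have "(cmod r - 1) * norm y \<le> norm (A (B y) - r *\<^sub>C y)" for y
      using order_trans[OF nA[of "B y"] nB[of y]] norm_triangle_ineq2[of "r *\<^sub>C y" "A (B y)"]
      by (simp add: norm_scaleC norm_minus_commute left_diff_distrib)
    then show ?thesis using big unfolding bounded_below_def by (intro exI[of _ "cmod r - 1"]) auto
  next
    case small: False
    have "Im r \<noteq> 0 \<or> Re r < 0"
    proof (rule ccontr)
      assume "\<not> ?thesis"
      then have "r = complex_of_real (Re r)" "0 \<le> Re r" by (auto simp: complex_eq_iff)
      moreover from this small have "Re r \<le> 1" by (metis abs_of_nonneg norm_of_real not_less)
      ultimately show False using not True by metis
    qed
    then obtain k where k: "k > 0" "\<And>w b. 0 \<le> w \<Longrightarrow> 0 \<le> b \<Longrightarrow> k * b \<le> cmod (complex_of_real w - r * complex_of_real b)"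
    proof
      assume "Im r \<noteq> 0"
      moreover have "\<bar>Im r\<bar> * b \<le> cmod (complex_of_real w - r * complex_of_real b)" if "0 \<le> b" for w b
        using abs_Im_le_cmod[of "complex_of_real w - r * complex_of_real b"] that by (simp add: abs_mult)
      ultimately show thesis using that[of "\<bar>Im r\<bar>"] by simp
    next
      assume "Re r < 0"
      moreover have "- Re r * b \<le> cmod (complex_of_real w - r * complex_of_real b)" if "0 \<le> w" for w b
        using complex_Re_le_cmod[of "complex_of_real w - r * complex_of_real b"] that by simp
      ultimately show thesis using that[of "- Re r"] by simp
    qed
    \<comment> \<open>with this constant, \<open>B y\<close> and the error each account for at most half of the norm of \<open>r y\<close>\<close>
    define c where "c = min (cmod r / 2) (k * (cmod r)\<^sup>2 / 4)"
    have c: "c > 0" "c \<le> cmod r / 2" "c \<le> k * (cmod r)\<^sup>2 / 4" using r k(1) by (auto simp: c_def)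
    have "c * norm y \<le> norm (A (B y) - r *\<^sub>C y)" for y
    proof (rule ccontr)
      define d where "d = A (B y) - r *\<^sub>C y"
      assume "\<not> ?thesis"
      then have d: "norm d < c * norm y" by (simp add: d_def)
      then have y: "norm y > 0" using c(1) by (smt (verit) norm_ge_zero mult_nonneg_nonneg mult_eq_0_iff)
      have "cinner (A (B y)) (B y) - r * cinner (B y) y = cinner d (B y)"
        by (simp add: d_def cinner_simps positive_contraction_cinner[OF B])
      then have "cmod (complex_of_real (inner (A (B y)) (B y)) - r * complex_of_real (inner (B y) y)) = cmod (cinner d (B y))"
        by (simp only: positive_contraction_cinner_self[OF A] positive_contraction_cinner_self[OF B])
      then have "k * inner (B y) y \<le> cmod (cinner d (B y))"
        using k(2)[OF positive_contraction_nonneg[OF A, of "B y"] positive_contraction_nonneg[OF B, of y]] by simp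
      also have "\<dots> \<le> norm d * norm y"
        using cmod_cinner_le[of d "B y"] nB[of y] by (meson mult_left_mono norm_ge_zero order_trans)
      also have "\<dots> \<le> c * norm y * norm y" using d by (intro mult_right_mono) auto
      finally have "k * inner (B y) y \<le> c * (norm y)\<^sup>2" by (simp add: power2_eq_square mult_ac)
      then have "k * (norm (B y))\<^sup>2 \<le> c * (norm y)\<^sup>2"
        using positive_contraction_norm_sq_le[OF B, of y] k(1) by (smt (verit) mult_left_mono)
      also have "\<dots> \<le> k * (cmod r)\<^sup>2 / 4 * (norm y)\<^sup>2" using c by (intro mult_right_mono) auto
      also have "\<dots> = k * (cmod r / 2 * norm y)\<^sup>2" by (simp add: power_mult_distrib power_divide)
      finally have "norm (B y) \<le> cmod r / 2 * norm y" using k(1) by (simp add: power2_le_iff_abs_le)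
      moreover have "cmod r * norm y \<le> norm (A (B y)) + norm d"
        using norm_triangle_ineq4[of "A (B y)" d] by (simp add: d_def norm_scaleC)
      moreover have "c * norm y \<le> cmod r / 2 * norm y" using c(2) by (intro mult_right_mono) auto
      ultimately show False using nA[of "B y"] d by linarith
    qed
    then show ?thesis using c(1) unfolding bounded_below_def by blast
  qed
qed

section \<open>The dilation and the bound for the numerical range\<close>

lemma norm_add_scaleR_sq:
  fixes u v :: "'a::real_inner"
  shows "(norm (u + t *\<^sub>R v))\<^sup>2 = (norm u)\<^sup>2 + 2 * t * inner u v + t\<^sup>2 * (norm v)\<^sup>2"
  unfolding power2_norm_eq_inner
  by (simp only: inner_add_left inner_add_right inner_scaleR_left inner_scaleR_right inner_commute[of v u])
    (simp add: algebra_simps power2_eq_square)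

text \<open>The squared norm of \<open>z = (x, 0, 0) + V A^(1/2) a + W B^(1/2) b\<close> in \<open>H \<oplus> H \<oplus> H\<close>, for the isometries
\<open>V = (A^(1/2), (1 - A)^(1/2), 0)\<close> and \<open>W = (B^(1/2), 0, (1 - B)^(1/2))\<close>.\<close>

definition dilation_form :: "('a::complex_inner \<Rightarrow> 'a) \<Rightarrow> ('a \<Rightarrow> 'a) \<Rightarrow> 'a \<Rightarrow> 'a \<Rightarrow> 'a \<Rightarrow> real" where
  "dilation_form A B x a b = (norm (x + A a + B b))\<^sup>2
     + (inner (A a) a - (norm (A a))\<^sup>2) + (inner (B b) b - (norm (B b))\<^sup>2)"

text \<open>The value \<open>Re (e * cinner (P (Q z)) z)\<close> at the same vector \<open>z\<close>, for the projections \<open>P = V V*\<close> and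
\<open>Q = W W*\<close>. Here \<open>V* z = A^(1/2) (x + a + B b)\<close> and \<open>W* z = B^(1/2) (x + b + A a)\<close>.\<close>

definition dilation_product :: "('a::complex_inner \<Rightarrow> 'a) \<Rightarrow> ('a \<Rightarrow> 'a) \<Rightarrow> complex \<Rightarrow> 'a \<Rightarrow> 'a \<Rightarrow> 'a \<Rightarrow> real" where
  "dilation_product A B e x a b = inner (e *\<^sub>C B (x + b + A a)) (A (x + a + B b))"

lemma dilation_form_swap: "dilation_form B A x b a = dilation_form A B x a b"
  by (simp add: dilation_form_def add_ac)

lemma dilation_product_swap: "dilation_product B A (cnj e) x b a = dilation_product A B e x a b"
  unfolding dilation_product_def by (subst inner_commute) (simp add: inner_scaleC_left)

lemma dilation_form_shift:
  assumes A: "positive_contraction A"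
  shows "dilation_form A B x (a + t *\<^sub>R g) b
    = dilation_form A B x a b + 2 * t * inner (A (x + a + B b)) g + t\<^sup>2 * inner (A g) g"
proof -
  note A_inner = positive_contraction_inner[OF A]
  have *: "inner (A (x + a + B b)) g = inner x (A g) + inner (A a) g + inner (B b) (A g)"
    by (simp add: A_inner inner_add_left)
  have **: "inner (A g) a = inner (A a) g" by (metis A_inner inner_commute)
  have A_add: "A (a + t *\<^sub>R g) = A a + t *\<^sub>R A g" by (simp add: positive_contraction_simps[OF A])
  have w: "x + (A a + t *\<^sub>R A g) + B b = (x + A a + B b) + t *\<^sub>R A g" by simp
  show ?thesis
    unfolding dilation_form_def A_add w * norm_add_scaleR_sq
    by (simp add: inner_add_left inner_add_right ** algebra_simps power2_eq_square)
qed

lemma dilation_product_shift: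
  assumes A: "positive_contraction A" and B: "positive_contraction B"
  shows "dilation_product A B e x (a + t *\<^sub>R g) b = dilation_product A B e x a b
    + t * inner (e *\<^sub>C A (B (x + b + A a)) + cnj e *\<^sub>C A (B (A (x + a + B b)))) g
    + t\<^sup>2 * inner (e *\<^sub>C B (A g)) (A g)"
proof -
  define p where "p = x + a + B b"
  define r where "r = x + b + A a"
  have pA: "A (x + (a + t *\<^sub>R g) + B b) = A p + t *\<^sub>R A g"
    by (simp add: p_def positive_contraction_simps[OF A])
  have rB: "e *\<^sub>C B (x + b + A (a + t *\<^sub>R g)) = e *\<^sub>C B r + t *\<^sub>R (e *\<^sub>C B (A g))"
    by (simp add: r_def positive_contraction_simps[OF A] positive_contraction_simps[OF B]
        scaleC_add_right scaleR_scaleC scaleC_scaleC mult.commute)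
  have 1: "inner (e *\<^sub>C B r) (A g) = inner (e *\<^sub>C A (B r)) g"
    by (simp add: positive_contraction_inner[OF A, symmetric] positive_contraction_simps[OF A])
  have "inner (e *\<^sub>C B (A g)) (A p) = inner g (A (B (cnj e *\<^sub>C A p)))"
    by (simp add: inner_scaleC_left positive_contraction_inner[OF A] positive_contraction_inner[OF B])
  then have 2: "inner (e *\<^sub>C B (A g)) (A p) = inner (cnj e *\<^sub>C A (B (A p))) g"
    by (simp add: positive_contraction_simps[OF A] positive_contraction_simps[OF B] inner_commute)
  show ?thesis
    unfolding dilation_product_def pA rB p_def[symmetric] r_def[symmetric]
    by (simp add: inner_add_left inner_add_right 1 2 algebra_simps power2_eq_square)
qed

text \<open>If a nonnegative form \<open>F\<close> grows at most like \<open>(m + 1) * (norm g)\<^sup>2\<close> in the direction of its gradient,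
then a step of the right length along the gradient shows that the gradient is small where \<open>F\<close> is
small. Here \<open>F\<close> is the form of \<open>m - N\<close>, where \<open>N\<close> is the real part of \<open>e P Q\<close>, and the vector on the left is its
gradient with respect to \<open>a\<close>; it vanishes where \<open>N z = m z\<close>.\<close>

lemma dilation_gradient_bound:
  assumes A: "positive_contraction A" and B: "positive_contraction B" and e: "cmod e = 1" and m: "0 \<le> m"
    and le: "\<And>x a b. dilation_product A B e x a b \<le> m * dilation_form A B x a b"
    and y: "y = A (x + a + B b)" and u: "u = B (x + b + A a)"
  shows "(norm (complex_of_real (2 * m) *\<^sub>C y - e *\<^sub>C A u - cnj e *\<^sub>C A (B y)))\<^sup>2
    \<le> 4 * (m + 1) * (m * dilation_form A B x a b - dilation_product A B e x a b)"
proof -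
  define g where "g = complex_of_real (2 * m) *\<^sub>C y - e *\<^sub>C A u - cnj e *\<^sub>C A (B y)"
  \<comment> \<open>the step that minimizes the quadratic upper bound for \<open>F\<close> along \<open>g\<close>\<close>
  define t where "t = - 1 / (2 * (m + 1))"
  have "inner (A g) g \<le> (norm g)\<^sup>2" by (rule positive_contraction_inner_le[OF A])
  then have "m * inner (A g) g \<le> m * (norm g)\<^sup>2" using m by (rule mult_left_mono)
  moreover have "- inner (e *\<^sub>C B (A g)) (A g) \<le> (norm g)\<^sup>2"
  proof -
    have "- inner (e *\<^sub>C B (A g)) (A g) \<le> norm (e *\<^sub>C B (A g)) * norm (A g)"
      using Cauchy_Schwarz_ineq2[of "e *\<^sub>C B (A g)" "A g"] by linarith
    also have "\<dots> \<le> norm g * norm g"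
      using positive_contraction_norm_le[OF B, of "A g"] positive_contraction_norm_le[OF A, of g] e
      by (intro mult_mono) (auto simp: norm_scaleC)
    finally show ?thesis by (simp add: power2_eq_square)
  qed
  ultimately have quad: "m * inner (A g) g - inner (e *\<^sub>C B (A g)) (A g) \<le> (m + 1) * (norm g)\<^sup>2"
    by (simp add: algebra_simps)
  have g_sq: "2 * m * inner y g - inner (e *\<^sub>C A u + cnj e *\<^sub>C A (B y)) g = (norm g)\<^sup>2"
  proof -
    have "inner (complex_of_real (2 * m) *\<^sub>C y - e *\<^sub>C A u - cnj e *\<^sub>C A (B y)) g = inner g g"
      by (simp only: g_def[symmetric])
    then show ?thesis
      by (simp only: inner_diff_left inner_add_left scaleR_scaleC[symmetric] inner_scaleR_left
          power2_norm_eq_inner diff_diff_eq)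
  qed
  have "0 \<le> m * dilation_form A B x (a + t *\<^sub>R g) b - dilation_product A B e x (a + t *\<^sub>R g) b"
    using le by simp
  also have "\<dots> = m * dilation_form A B x a b - dilation_product A B e x a b
      + t * (2 * m * inner y g - inner (e *\<^sub>C A u + cnj e *\<^sub>C A (B y)) g)
      + t\<^sup>2 * (m * inner (A g) g - inner (e *\<^sub>C B (A g)) (A g))"
    unfolding dilation_form_shift[OF A] dilation_product_shift[OF A B] y u by (simp add: algebra_simps)
  also have "\<dots> \<le> m * dilation_form A B x a b - dilation_product A B e x a b
      + t * (norm g)\<^sup>2 + t\<^sup>2 * ((m + 1) * (norm g)\<^sup>2)"
    unfolding g_sq by (intro add_left_mono mult_left_mono quad) auto
  also have "\<dots> = m * dilation_form A B x a b - dilation_product A B e x a b - (norm g)\<^sup>2 / (4 * (m + 1))"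
  proof -
    define M where "M = m + 1"
    have "0 < M" using m by (simp add: M_def)
    then have "t * (norm g)\<^sup>2 + t\<^sup>2 * (M * (norm g)\<^sup>2) = - ((norm g)\<^sup>2 / (4 * M))"
      unfolding t_def M_def[symmetric] by (simp add: power2_eq_square)
    then show ?thesis by (simp add: M_def)
  qed
  finally have "(norm g)\<^sup>2 / (4 * (m + 1)) \<le> m * dilation_form A B x a b - dilation_product A B e x a b"
    by simp
  then show ?thesis using m unfolding g_def[symmetric] by (simp add: pos_divide_le_eq mult.commute)
qed

text \<open>Bounds for \<open>z\<close> and \<open>A^(1/2) (V* z)\<close>. They follow from
\<open>A (x + a + B b) = A (x + A a + B b) + (A - A\<^sup>2) a\<close>, where both terms are controlled by
\<open>dilation_form\<close>.\<close>

lemma dilation_form_bounds: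
  assumes A: "positive_contraction A" and B: "positive_contraction B"
  shows "0 \<le> dilation_form A B x a b" "norm (A (x + a + B b)) \<le> 2 * sqrt (dilation_form A B x a b)"
proof -
  define w where "w = x + A a + B b"
  have nonneg: "0 \<le> inner (A a) a - (norm (A a))\<^sup>2" "0 \<le> inner (B b) b - (norm (B b))\<^sup>2"
    using positive_contraction_norm_sq_le[OF A, of a] positive_contraction_norm_sq_le[OF B, of b] by simp_all
  then show "0 \<le> dilation_form A B x a b" by (simp add: dilation_form_def)
  have "norm w \<le> sqrt (dilation_form A B x a b)"
    using nonneg by (intro real_le_rsqrt) (simp add: dilation_form_def w_def)
  moreover have "norm (A a - A (A a)) \<le> sqrt (dilation_form A B x a b)"
  proof (rule real_le_rsqrt)
    show "(norm (A a - A (A a)))\<^sup>2 \<le> dilation_form A B x a b"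
      unfolding dilation_form_def w_def[symmetric]
      using nonneg positive_contraction_defect[OF A, of a] zero_le_power2[of "norm w"] by linarith
  qed
  moreover have "A (x + a + B b) = A w + (A a - A (A a))"
    by (simp add: w_def positive_contraction_simps[OF A])
  then have "norm (A (x + a + B b)) \<le> norm w + norm (A a - A (A a))"
    using norm_triangle_ineq[of "A w" "A a - A (A a)"] positive_contraction_norm_le[OF A, of w] by simp
  ultimately show "norm (A (x + a + B b)) \<le> 2 * sqrt (dilation_form A B x a b)" by linarith
qed

lemma dilation_product_le_norms:
  "cmod e = 1 \<Longrightarrow> dilation_product A B e x a b \<le> norm (B (x + b + A a)) * norm (A (x + a + B b))"
  using norm_cauchy_schwarz[of "e *\<^sub>C B (x + b + A a)" "A (x + a + B b)"]
  by (simp add: dilation_product_def norm_scaleC)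

lemma dilation_product_le:
  assumes A: "positive_contraction A" and B: "positive_contraction B" and e: "cmod e = 1"
  shows "dilation_product A B e x a b \<le> 4 * dilation_form A B x a b"
proof -
  let ?q = "sqrt (dilation_form A B x a b)"
  have "dilation_product A B e x a b \<le> norm (B (x + b + A a)) * norm (A (x + a + B b))"
    by (rule dilation_product_le_norms[OF e])
  also have "\<dots> \<le> (2 * ?q) * (2 * ?q)"
    using dilation_form_bounds[OF A B, of x a b] dilation_form_bounds(2)[OF B A, of x b a]
    unfolding dilation_form_swap[of B A] by (intro mult_mono) auto
  also have "\<dots> = 4 * dilation_form A B x a b"
    using dilation_form_bounds(1)[OF A B, of x a b] by simp
  finally show ?thesis .
qed

text \<open>The quadratic splits into two linear factors over the complex numbers. Their roots are nonzero because their
product is \<open>4 * m\<^sup>2\<close>, and neither is a spectral value in the unit interval, where the quadratic is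
positive. So both factors are bounded below.\<close>

lemma product_quadratic_bounded_below:
  assumes A: "positive_contraction A" and B: "positive_contraction B" and e: "cmod e = 1" and m: "0 < m"
    and less: "\<And>l. 0 \<le> l \<Longrightarrow> l \<le> 1 \<Longrightarrow> complex_of_real l \<in> op_spectrum (A \<circ> B) \<Longrightarrow> disk_support e l < m"
  obtains c where "c > 0" "\<And>y. c * norm y \<le> norm (A (B (A (B y)))
    - complex_of_real (4 * m * Re e + 1) *\<^sub>C A (B y) + complex_of_real (4 * m\<^sup>2) *\<^sub>C y)"
proof -
  define s where "s = 4 * m * Re e + 1"
  define D where "D = csqrt (complex_of_real (s\<^sup>2 - 16 * m\<^sup>2))"
  define r1 r2 where "r1 = (complex_of_real s + D) / 2" and "r2 = (complex_of_real s - D) / 2"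
  have D2: "D * D = complex_of_real (s\<^sup>2 - 16 * m\<^sup>2)"
    by (simp only: D_def power2_csqrt power2_eq_square[symmetric])
  have sum: "r1 + r2 = complex_of_real s" by (simp add: r1_def r2_def field_simps)
  have "4 * (r1 * r2) = (2 * r1) * (2 * r2)" by simp
  also have "\<dots> = (complex_of_real s + D) * (complex_of_real s - D)"
  proof -
    have "2 * r1 = complex_of_real s + D" "2 * r2 = complex_of_real s - D" by (simp_all add: r1_def r2_def)
    then show ?thesis by (simp only:)
  qed
  also have "\<dots> = complex_of_real (s\<^sup>2) - D * D" by (simp add: algebra_simps power2_eq_square)
  finally have "4 * (r1 * r2) = complex_of_real (s\<^sup>2) - D * D" .
  then have prod: "r1 * r2 = complex_of_real (4 * m\<^sup>2)" by (simp add: D2)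
  have nz: "r1 \<noteq> 0" "r2 \<noteq> 0" using prod m by auto
  have root: "r * r - complex_of_real s * r + complex_of_real (4 * m\<^sup>2) = 0" if "r = r1 \<or> r = r2" for r
    using that unfolding sum[symmetric] prod[symmetric] by (auto simp: algebra_simps)
  have bb: "bounded_below (\<lambda>y. A (B y) - r *\<^sub>C y)" if r: "r = r1 \<or> r = r2" for r
  proof (rule product_minus_scalar_bounded_below[OF A B])
    show "r \<noteq> 0" using r nz by auto
    fix l :: real assume l: "0 \<le> l" "l \<le> 1" "complex_of_real l \<in> op_spectrum (A \<circ> B)"
    have pos: "0 < l\<^sup>2 - s * l + 4 * m\<^sup>2"
      unfolding s_def using quadratic_pos_above_disk_support[OF e l(1,2) less[OF l]] .
    show "r \<noteq> complex_of_real l"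
    proof
      assume "r = complex_of_real l"
      with root[OF r] have "complex_of_real (l * l - s * l + 4 * m\<^sup>2) = complex_of_real 0"
        by (simp only: of_real_mult of_real_add of_real_diff of_real_0)
      then have "l * l - s * l + 4 * m\<^sup>2 = 0" by (simp only: of_real_eq_iff)
      with pos show False by (simp add: power2_eq_square)
    qed
  qed
  obtain c1 where c1: "c1 > 0" "\<And>y. c1 * norm y \<le> norm (A (B y) - r1 *\<^sub>C y)"
    using bb[of r1] unfolding bounded_below_def by blast
  obtain c2 where c2: "c2 > 0" "\<And>y. c2 * norm y \<le> norm (A (B y) - r2 *\<^sub>C y)"
    using bb[of r2] unfolding bounded_below_def by blast
  have "c1 * c2 * norm y \<le> norm (A (B (A (B y)))
    - complex_of_real s *\<^sub>C A (B y) + complex_of_real (4 * m\<^sup>2) *\<^sub>C y)" for y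
  proof -
    define v where "v = A (B y) - r2 *\<^sub>C y"
    have "c1 * c2 * norm y \<le> c1 * norm v"
      using c2(2)[of y] c1(1) by (simp add: v_def mult.assoc)
    also have "\<dots> \<le> norm (A (B v) - r1 *\<^sub>C v)" by (rule c1(2))
    also have "A (B v) - r1 *\<^sub>C v = A (B (A (B y))) - (r1 + r2) *\<^sub>C A (B y) + (r1 * r2) *\<^sub>C y"
      by (simp add: v_def positive_contraction_simps[OF A] positive_contraction_simps[OF B]
          scaleC_add_left complex_vector.scale_right_diff_distrib scaleC_scaleC algebra_simps)
    finally show ?thesis unfolding sum prod .
  qed
  moreover have "c1 * c2 > 0" using c1 c2 by simp
  ultimately show ?thesis using that[of "c1 * c2"] unfolding s_def by blast
qed

text \<open>Elimination of \<open>u\<close> from the two approximate eigenvector equations for \<open>y = A^(1/2) (V* z)\<close> and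
\<open>u = B^(1/2) (W* z)\<close>, with error terms \<open>G\<close> and \<open>H\<close>.\<close>

lemma gradient_elimination:
  assumes A: "positive_contraction A" and B: "positive_contraction B" and e: "cmod e = 1"
    and G: "G = complex_of_real (2 * m) *\<^sub>C y - e *\<^sub>C A u - cnj e *\<^sub>C A (B y)"
    and H: "H = complex_of_real (2 * m) *\<^sub>C u - cnj e *\<^sub>C B y - e *\<^sub>C B (A u)"
  shows "A (B (A (B y))) - complex_of_real (4 * m * Re e + 1) *\<^sub>C A (B y) + complex_of_real (4 * m\<^sup>2) *\<^sub>C y
    = complex_of_real (2 * m) *\<^sub>C G - e *\<^sub>C A (B G) + e *\<^sub>C A H"
proof -
  let ?m = "complex_of_real m"
  have ee: "e * cnj e = 1" "cnj e * e = 1" using e by (simp_all add: complex_norm_square[symmetric] mult.commute)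
  have s: "complex_of_real (4 * m * Re e + 1) = 2 * ?m * e + 2 * ?m * cnj e + 1"
  proof -
    have "complex_of_real (4 * m * Re e + 1) = 2 * ?m * (e + cnj e) + 1"
      unfolding complex_add_cnj by simp
    then show ?thesis by (simp add: distrib_left)
  qed
  show ?thesis unfolding s G H
    by (simp add: positive_contraction_simps[OF A] positive_contraction_simps[OF B] scaleC_add_left
        scaleC_add_right complex_vector.scale_right_diff_distrib scaleC_scaleC ee algebra_simps power2_eq_square)
qed

text \<open>Let \<open>m\<close> be the least number with \<open>dilation_product \<le> m * dilation_form\<close>. If \<open>m > h\<close>, the gradient
estimate, the elimination and the lower bound for the quadratic show that \<open>y\<close> and \<open>u\<close> are bounded by
the square root of \<open>m * dilation_form - dilation_product\<close>. Since \<open>dilation_product\<close> is at most the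
product of their norms, it is then at most a multiple of this difference, so \<open>m\<close> can be
lowered. The triple \<open>(x, 0, 0)\<close> gives the asserted inequality.\<close>

theorem product_quadratic_form_le:
  assumes A: "positive_contraction A" and B: "positive_contraction B" and e: "cmod e = 1" and h: "0 \<le> h"
    and le: "\<And>l. 0 \<le> l \<Longrightarrow> l \<le> 1 \<Longrightarrow> complex_of_real l \<in> op_spectrum (A \<circ> B) \<Longrightarrow> disk_support e l \<le> h"
  shows "Re (e * cinner (A (B x)) x) \<le> h * (norm x)\<^sup>2"
proof (rule ccontr)
  assume neg: "\<not> ?thesis"
  define L where "L = {k. \<forall>x a b. dilation_product A B e x a b \<le> k * dilation_form A B x a b}"
  define m where "m = Inf L"
  have form0: "dilation_form A B x 0 0 = (norm x)\<^sup>2"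
    by (simp add: dilation_form_def positive_contraction_simps[OF A] positive_contraction_simps[OF B])
  have prod0: "dilation_product A B e x 0 0 = Re (e * cinner (A (B x)) x)"
    by (simp add: dilation_product_def positive_contraction_simps[OF A] positive_contraction_simps[OF B]
        inner_eq_Re_cinner cinner_simps positive_contraction_cinner[OF A])
  have gt: "h * (norm x)\<^sup>2 < dilation_product A B e x 0 0"
    using neg by (simp add: prod0)
  then have "x \<noteq> 0" using prod0 by auto
  then have x: "0 < (norm x)\<^sup>2" by simp
  define k0 where "k0 = dilation_product A B e x 0 0 / (norm x)\<^sup>2"
  have k0: "h < k0" using gt x by (simp add: k0_def pos_less_divide_eq)
  have k0_le: "k0 \<le> k" if "k \<in> L" for k
  proof -
    have "dilation_product A B e x 0 0 \<le> k * dilation_form A B x 0 0" using that by (simp add: L_def)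
    then show ?thesis using x by (simp add: k0_def form0 pos_divide_le_eq)
  qed
  have L4: "4 \<in> L" using dilation_product_le[OF A B e] by (simp add: L_def)
  have bdd: "bdd_below L" using k0_le by (rule bdd_belowI)
  have mL: "m \<in> L"
  proof -
    have "dilation_product A B e x a b \<le> m * dilation_form A B x a b" for x a b
    proof (cases "dilation_form A B x a b = 0")
      case True
      then show ?thesis using dilation_product_le[OF A B e, of x a b] by simp
    next
      case False
      then have pos: "0 < dilation_form A B x a b" using dilation_form_bounds(1)[OF A B, of x a b] by simp
      have "dilation_product A B e x a b / dilation_form A B x a b \<le> m"
        unfolding m_def using L4 pos by (intro cInf_greatest) (auto simp: L_def pos_divide_le_eq)
      then show ?thesis using pos by (simp add: pos_divide_le_eq)
    qed
    then show ?thesis by (simp add: L_def)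
  qed
  have m: "h < m" using k0_le[OF mL] k0 by simp
  then have m0: "0 < m" using h by simp
  have less: "disk_support e l < m" if "0 \<le> l" "l \<le> 1" "complex_of_real l \<in> op_spectrum (A \<circ> B)" for l
    using le[OF that] m by simp
  obtain c where c: "c > 0" "\<And>y. c * norm y \<le> norm (A (B (A (B y)))
    - complex_of_real (4 * m * Re e + 1) *\<^sub>C A (B y) + complex_of_real (4 * m\<^sup>2) *\<^sub>C y)"
    using product_quadratic_bounded_below[OF A B e m0] less by blast
  define K1 where "K1 = (2 * m + 2) / c"
  define K2 where "K2 = ((2 * m + 2) * K1 + 2) / (2 * m)"
  define K where "K = K2 * K1 * (4 * (m + 1))"
  have K: "0 \<le> K1" "0 \<le> K2" "0 \<le> K" using m0 c(1) by (simp_all add: K1_def K2_def K_def)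
  note nA = positive_contraction_norm_le[OF A] and nB = positive_contraction_norm_le[OF B]
  \<comment> \<open>near a maximum of the form both factors of the product are small\<close>
  have key: "dilation_product A B e x a b
      \<le> K * (m * dilation_form A B x a b - dilation_product A B e x a b)" for x a b
  proof -
    define y where "y = A (x + a + B b)"
    define u where "u = B (x + b + A a)"
    define G where "G = complex_of_real (2 * m) *\<^sub>C y - e *\<^sub>C A u - cnj e *\<^sub>C A (B y)"
    define H where "H = complex_of_real (2 * m) *\<^sub>C u - cnj e *\<^sub>C B y - e *\<^sub>C B (A u)"
    define F where "F = m * dilation_form A B x a b - dilation_product A B e x a b"
    define q where "q = sqrt (4 * (m + 1) * F)"
    have F: "0 \<le> F" using mL by (simp add: F_def L_def)
    have q: "0 \<le> q" "q\<^sup>2 = 4 * (m + 1) * F" using F m0 by (simp_all add: q_def)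
    have "norm G \<le> q"
      unfolding q_def G_def F_def using mL m0
      by (intro real_le_rsqrt dilation_gradient_bound[OF A B e _ _ y_def u_def]) (simp_all add: L_def)
    moreover have "norm H \<le> q"
    proof -
      have "dilation_product B A (cnj e) x a b \<le> m * dilation_form B A x a b" for x a b
        using mL unfolding dilation_product_swap[of B A e x a b] dilation_form_swap[of B A x a b]
        by (simp add: L_def)
      from dilation_gradient_bound[OF B A _ _ this u_def y_def] m0 e
      have "(norm H)\<^sup>2 \<le> 4 * (m + 1) * F"
        by (simp add: H_def F_def dilation_product_swap[of B A e] dilation_form_swap[of B A])
      then show ?thesis unfolding q_def by (rule real_le_rsqrt)
    qed
    ultimately have GH: "norm G \<le> q" "norm H \<le> q" .
    have "c * norm y \<le> norm (complex_of_real (2 * m) *\<^sub>C G - e *\<^sub>C A (B G) + e *\<^sub>C A H)"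
      unfolding gradient_elimination[OF A B e G_def H_def, symmetric] by (rule c(2))
    also have "\<dots> \<le> norm (complex_of_real (2 * m) *\<^sub>C G) + norm (e *\<^sub>C A (B G)) + norm (e *\<^sub>C A H)"
      by (rule order_trans[OF norm_triangle_ineq add_right_mono[OF norm_triangle_ineq4]])
    also have "\<dots> \<le> 2 * m * q + q + q"
    proof (intro add_mono)
      show "norm (complex_of_real (2 * m) *\<^sub>C G) \<le> 2 * m * q"
        using GH m0 by (simp add: norm_scaleC norm_mult)
      show "norm (e *\<^sub>C A (B G)) \<le> q" using nA[of "B G"] nB[of G] GH e by (simp add: norm_scaleC)
      show "norm (e *\<^sub>C A H) \<le> q" using nA[of H] GH e by (simp add: norm_scaleC)
    qed
    finally have y: "norm y \<le> K1 * q" using c(1) by (simp add: K1_def field_simps)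
    have "e *\<^sub>C A u = complex_of_real (2 * m) *\<^sub>C y - cnj e *\<^sub>C A (B y) - G"
      by (simp add: G_def)
    then have "norm (e *\<^sub>C A u) \<le> norm (complex_of_real (2 * m) *\<^sub>C y) + norm (cnj e *\<^sub>C A (B y)) + norm G"
      by (metis order_trans[OF norm_triangle_ineq4 add_right_mono[OF norm_triangle_ineq4]])
    then have Au: "norm (A u) \<le> 2 * m * norm y + norm y + q"
      using nA[of "B y"] nB[of y] GH e m0 by (simp add: norm_scaleC norm_mult)
    have "complex_of_real (2 * m) *\<^sub>C u = cnj e *\<^sub>C B y + e *\<^sub>C B (A u) + H"
      by (simp add: H_def)
    then have "norm (complex_of_real (2 * m) *\<^sub>C u) \<le> norm (cnj e *\<^sub>C B y) + norm (e *\<^sub>C B (A u)) + norm H"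
      by (metis order_trans[OF norm_triangle_ineq add_right_mono[OF norm_triangle_ineq]])
    then have "2 * m * norm u \<le> norm y + norm (A u) + q"
      using nB[of y] nB[of "A u"] GH e m0 by (simp add: norm_scaleC norm_mult)
    also have "\<dots> \<le> (2 * m + 2) * norm y + 2 * q" using Au by (simp add: algebra_simps)
    also have "\<dots> \<le> (2 * m + 2) * (K1 * q) + 2 * q" using y m0 by (intro add_right_mono mult_left_mono) auto
    finally have u: "norm u \<le> K2 * q" using m0 by (simp add: K2_def field_simps)
    have "dilation_product A B e x a b \<le> norm u * norm y"
      unfolding u_def y_def by (rule dilation_product_le_norms[OF e])
    also have "\<dots> \<le> (K2 * q) * (K1 * q)" using u y K q by (intro mult_mono) auto
    also have "\<dots> = K2 * K1 * q\<^sup>2" by (simp add: power2_eq_square)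
    also have "\<dots> = K * F" by (simp add: q(2) K_def)
    finally show ?thesis by (simp add: F_def)
  qed
  \<comment> \<open>solving \<open>key\<close> for the product gives a bound that is strictly smaller than \<open>m\<close>\<close>
  have "K * m / (1 + K) \<in> L"
  proof -
    have "dilation_product A B e x a b \<le> K * m / (1 + K) * dilation_form A B x a b" for x a b
    proof -
      have "(1 + K) * dilation_product A B e x a b \<le> K * m * dilation_form A B x a b"
        using key[of x a b] by (simp add: algebra_simps)
      then show ?thesis using K(3) by (simp add: pos_le_divide_eq mult.commute)
    qed
    then show ?thesis by (simp add: L_def)
  qed
  then have "m \<le> K * m / (1 + K)" unfolding m_def by (rule cInf_lower[OF _ bdd])
  then show False using K(3) m0 by (simp add: pos_le_divide_eq algebra_simps)
qed

section \<open>The convex hull of the disks and the Toeplitz-Hausdorff theorem\<close>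

lemma separate_from_closed_convex:
  assumes "convex S" "closed S" "w \<in> S" "z \<notin> S"
  obtains e h where "cmod e = 1" "h < Re (e * z)" "\<And>w. w \<in> S \<Longrightarrow> Re (e * w) < h"
proof -
  obtain a b where ab: "inner a z < b" "\<And>w. w \<in> S \<Longrightarrow> b < inner a w"
    using separating_hyperplane_closed_point[OF assms(1,2,4)] by blast
  have a: "cmod a > 0" using ab(1) ab(2)[OF assms(3)] by auto
  define e where "e = - cnj a / complex_of_real (cmod a)"
  have "cmod e = 1" using a by (simp add: e_def norm_divide)
  moreover have Re_e: "Re (e * w) = - inner a w / cmod a" for w
    by (simp add: e_def inner_complex_def Re_divide_of_real add_divide_distrib diff_divide_distrib)
  moreover have "- b / cmod a < Re (e * z)"
    unfolding Re_e using ab(1) a by (intro divide_strict_right_mono) auto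
  moreover have "Re (e * w) < - b / cmod a" if "w \<in> S" for w
    unfolding Re_e using ab(2)[OF that] a by (intro divide_strict_right_mono) auto
  ultimately show ?thesis using that by blast
qed

text \<open>If no spectral value lies in the unit interval, then \<open>product_quadratic_form_le\<close> applies with \<open>h = 0\<close>
in all directions. So the quadratic form of \<open>A B\<close> vanishes, \<open>A B = 0\<close>, and \<open>0\<close> is a spectral value
after all.\<close>

lemma real_spectrum_product_nonempty:
  fixes A B :: "'a::complex_inner \<Rightarrow> 'a" and x :: 'a
  assumes A: "positive_contraction A" and B: "positive_contraction B" and x: "x \<noteq> 0"
  obtains l where "0 \<le> l" "l \<le> 1" "complex_of_real l \<in> op_spectrum (A \<circ> B)"
proof (rule ccontr)
  assume "\<not> thesis"
  then have none: "complex_of_real l \<notin> op_spectrum (A \<circ> B)" if "0 \<le> l" "l \<le> 1" for l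
    using that \<open>\<And>l. 0 \<le> l \<Longrightarrow> l \<le> 1 \<Longrightarrow> complex_of_real l \<in> op_spectrum (A \<circ> B) \<Longrightarrow> thesis\<close> by blast
  have le: "Re (e * cinner (A (B y)) y) \<le> 0" if "cmod e = 1" for e y
    using product_quadratic_form_le[OF A B that order_refl, of y] none by simp
  have "cinner (A (B y)) y = 0" for y
    using le[of 1 y] le[of "-1" y] le[of \<i> y] le[of "-\<i>" y] by (simp add: complex_eq_iff)
  then have AB: "A (B y) = 0" for y
    by (rule zero_if_quadratic_form_zero[OF bounded_clinear_comp[OF positive_contraction_bounded_clinear[OF A]
        positive_contraction_bounded_clinear[OF B]]])
  have "invertible_operator (\<lambda>y. (A \<circ> B) y - complex_of_real 0 *\<^sub>C y)"
    using none[of 0] by (simp add: op_spectrum_def)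
  then have "invertible_operator (\<lambda>y. 0 :: 'a)" by (simp add: AB)
  then obtain Y :: "'a \<Rightarrow> 'a" where "(\<lambda>y. 0) \<circ> Y = id" unfolding invertible_operator_def by blast
  from fun_cong[OF this, of x] x show False by simp
qed

text \<open>The hull contains \<open>0\<close>, the common focus of the disks. So the constant \<open>h\<close> of a separating line is
nonnegative, as \<open>product_quadratic_form_le\<close> requires.\<close>

theorem numerical_range_product_subset:
  fixes A B :: "'a::chilbert_space \<Rightarrow> 'a"
  assumes A: "positive_contraction A" and B: "positive_contraction B"
  defines "\<Omega> \<equiv> convex hull (\<Union>l\<in>{l. complex_of_real l \<in> op_spectrum (A \<circ> B)}. elliptical_disk l)"
  shows "numerical_range (A \<circ> B) \<subseteq> \<Omega>" "closed \<Omega>"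
proof -
  have AB: "bounded_clinear (A \<circ> B)"
    using bounded_clinear_comp[OF positive_contraction_bounded_clinear[OF A] positive_contraction_bounded_clinear[OF B]]
    by (simp add: o_def)
  show "closed \<Omega>"
    unfolding \<Omega>_def
    by (intro compact_imp_closed compact_convex_hull compact_Union_elliptical_disk closed_real_spectrum[OF AB])
  show "numerical_range (A \<circ> B) \<subseteq> \<Omega>"
  proof (rule ccontr)
    assume "\<not> ?thesis"
    then obtain x where x: "norm x = 1" "cinner (A (B x)) x \<notin> \<Omega>"
      by (auto simp: numerical_range_def)
    then have "x \<noteq> 0" by auto
    then obtain l0 where l0: "0 \<le> l0" "l0 \<le> 1" "complex_of_real l0 \<in> op_spectrum (A \<circ> B)"
      using real_spectrum_product_nonempty[OF A B] by blast
    have "l0 * l0 \<le> l0" using l0 by (simp add: mult_left_le)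
    then have "l0 \<le> sqrt l0" by (intro real_le_rsqrt) (simp add: power2_eq_square)
    then have "0 \<in> elliptical_disk l0" using l0 by (simp add: elliptical_disk_def)
    then have zero: "0 \<in> \<Omega>" unfolding \<Omega>_def using l0(3) by (intro hull_inc) blast
    have "convex \<Omega>" by (simp add: \<Omega>_def)
    then obtain e h where e: "cmod e = 1" and gt: "h < Re (e * cinner (A (B x)) x)"
      and lt: "\<And>w. w \<in> \<Omega> \<Longrightarrow> Re (e * w) < h"
      using separate_from_closed_convex[OF _ \<open>closed \<Omega>\<close> zero x(2)] by blast
    have "Re (e * cinner (A (B x)) x) \<le> h * (norm x)\<^sup>2"
    proof (rule product_quadratic_form_le[OF A B e])
      show "0 \<le> h" using lt[OF zero] by simp
      fix l :: real assume l: "0 \<le> l" "l \<le> 1" "complex_of_real l \<in> op_spectrum (A \<circ> B)"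
      obtain w where w: "w \<in> elliptical_disk l" "Re (e * w) = disk_support e l"
        using disk_support_attained[OF e l(1,2)] by blast
      have "w \<in> \<Omega>" unfolding \<Omega>_def using w(1) l(3) by (intro hull_inc) blast
      then show "disk_support e l \<le> h" using lt w(2) by fastforce
    qed
    with gt x(1) show False by simp
  qed
qed

text \<open>An affine change of the operator moves the two given values to \<open>0\<close> and \<open>1\<close>; its form is \<open>s\<close> below. A
phase \<open>w\<close> makes the values of \<open>s\<close> real along the segment from \<open>w x\<close> to \<open>y\<close>, and the
intermediate value theorem gives the numbers between.\<close>

theorem Toeplitz_Hausdorff:
  assumes T: "bounded_clinear T"
  shows "convex (numerical_range T)"
  unfolding convex_alt
proof (intro ballI allI impI)
  fix a b :: complex and u :: real
  assume "a \<in> numerical_range T" "b \<in> numerical_range T" and u: "0 \<le> u \<and> u \<le> 1"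
  then obtain x y where x: "norm x = 1" "a = cinner (T x) x" and y: "norm y = 1" "b = cinner (T y) y"
    by (auto simp: numerical_range_def)
  show "(1 - u) *\<^sub>R a + u *\<^sub>R b \<in> numerical_range T"
  proof (cases "a = b")
    case True
    then show ?thesis using \<open>a \<in> numerical_range T\<close> by (simp flip: scaleR_add_left)
  next
    case False
    define s where "s v w = (cinner (T v) w - a * cinner v w) / (b - a)" for v w
    have s_add: "s (v + v') w = s v w + s v' w" "s v (w + w') = s v w + s v w'" for v v' w w'
      by (simp_all add: s_def bounded_clinear_simps[OF T] cinner_simps distrib_left add_divide_distrib diff_divide_distrib)
    have s_scale: "s (c *\<^sub>C v) w = c * s v w" "s v (c *\<^sub>C w) = cnj c * s v w" for c v w
      by (simp_all add: s_def bounded_clinear_simps[OF T] cinner_simps right_diff_distrib mult.left_commute)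
    have s_scaleR: "s (r *\<^sub>R v) w = of_real r * s v w" "s v (r *\<^sub>R w) = of_real r * s v w" for r v w
      by (simp_all add: scaleR_scaleC s_scale)
    have sx: "s x x = 0" and sy: "s y y = 1"
      using x y False by (simp_all add: s_def cinner_self)
    define d where "d = s x y - cnj (s y x)"
    \<comment> \<open>the phase that makes the sum of the two cross terms real\<close>
    define w where "w = (if d = 0 then 1 else cnj (sgn d))"
    have w: "cmod w = 1" by (simp add: w_def norm_sgn)
    have "Im (w * d) = 0"
    proof (cases "d = 0")
      case False
      have "cnj (sgn d) * d = complex_of_real (cmod d)"
        using False by (simp add: sgn_eq complex_norm_square[symmetric] power2_eq_square field_simps)
      then show ?thesis using False by (simp add: w_def)
    qed simp
    then have Im0: "Im (w * s x y + cnj w * s y x) = 0" by (simp add: d_def algebra_simps)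
    define k where "k = Re (w * s x y + cnj w * s y x)"
    have k: "w * s x y + cnj w * s y x = complex_of_real k" using Im0 by (simp add: k_def complex_eq_iff)
    define z where "z t = (1 - t) *\<^sub>R (w *\<^sub>C x) + t *\<^sub>R y" for t
    have sz: "s (z t) (z t) = complex_of_real (t * (1 - t) * k + t\<^sup>2)" for t
    proof -
      have "s (z t) (z t) = of_real (t * (1 - t)) * (w * s x y + cnj w * s y x) + of_real (t * t)"
        unfolding z_def s_add s_scaleR s_scale sx sy by (simp add: algebra_simps)
      then show ?thesis by (simp add: k power2_eq_square)
    qed
    \<comment> \<open>the segment avoids \<open>0\<close>: otherwise \<open>y\<close> would be a unit multiple of \<open>x\<close> and \<open>a = b\<close>\<close>
    have nz: "z t \<noteq> 0" if t: "0 \<le> t" "t \<le> 1" for t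
    proof
      assume "z t = 0"
      then have eq: "t *\<^sub>R y = - ((1 - t) *\<^sub>R (w *\<^sub>C x))"
        by (simp add: z_def add_eq_0_iff)
      then have "norm (t *\<^sub>R y) = norm ((1 - t) *\<^sub>R (w *\<^sub>C x))" by simp
      then have t: "t = 1 / 2" using t x y w by (simp add: norm_scaleC)
      have "(1 / 2) *\<^sub>R y = (1 / 2) *\<^sub>R (- (w *\<^sub>C x))" using eq unfolding t by simp
      then have "y = - (w *\<^sub>C x)" unfolding scaleR_cancel_left by simp
      then have "b = w * cnj w * a"
        unfolding x(2) y(2) by (simp add: bounded_clinear_simps[OF T] cinner_minus_left cinner_minus_right cinner_simps)
      then show False using w False by (simp add: complex_norm_square[symmetric])
    qed
    define f where "f t = (t * (1 - t) * k + t\<^sup>2) / (norm (z t))\<^sup>2" for t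
    have "continuous_on {0..1} f"
      unfolding f_def using nz unfolding z_def by (intro continuous_intros) auto
    moreover have "f 0 \<le> u" "u \<le> f 1" using u y by (simp_all add: f_def z_def)
    ultimately obtain t where t: "0 \<le> t" "t \<le> 1" "f t = u"
      using IVT'[of f 0 u 1] by auto
    define v where "v = (1 / norm (z t)) *\<^sub>R z t"
    have v: "norm v = 1" using nz[OF t(1,2)] by (simp add: v_def)
    have "s v v = complex_of_real u"
      unfolding v_def s_scaleR sz t(3)[symmetric] f_def by (simp add: power2_eq_square)
    moreover have "s v v = (cinner (T v) v - a) / (b - a)" using v by (simp add: s_def cinner_self)
    ultimately have "cinner (T v) v - a = complex_of_real u * (b - a)"
      using False by (simp add: nonzero_divide_eq_eq)
    then have "cinner (T v) v = (1 - u) *\<^sub>R a + u *\<^sub>R b"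
      by (simp add: scaleR_conv_of_real algebra_simps)
    then show ?thesis using v unfolding numerical_range_def by force
  qed
qed

section \<open>Spectral values of a product of projections\<close>

text \<open>If \<open>c \<le> \<bar>S\<bar> \<le> K\<close>, then \<open>1 - S\<^sup>2 / K\<^sup>2\<close> is strictly contractive, so \<open>S / K\<^sup>2\<close> is an approximate left
inverse of \<open>S\<close>.\<close>

lemma selfadjoint_bounded_below_surj:
  fixes S :: "'a::chilbert_space \<Rightarrow> 'a"
  assumes S: "bounded_clinear S" and sym: "\<And>x y. inner (S x) y = inner x (S y)" and bb: "bounded_below S"
  shows "surj S"
proof -
  obtain c where c: "c > 0" "\<And>x. c * norm x \<le> norm (S x)" using bb unfolding bounded_below_def by blast
  obtain K0 where K0: "K0 > 0" "\<And>x. norm (S x) \<le> norm x * K0"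
    using bounded_linear.pos_bounded[of S] S unfolding bounded_clinear_def by blast
  define K where "K = max K0 c"
  have K: "K > 0" "c \<le> K" using K0(1) by (simp_all add: K_def)
  have SK: "norm (S x) \<le> K * norm x" for x
    using K0(2)[of x] mult_right_mono[of K0 K "norm x"] by (simp add: K_def mult.commute)
  define q where "q = 1 - c\<^sup>2 / K\<^sup>2"
  have q: "0 \<le> q" "q < 1" using K c(1) by (simp_all add: q_def power_mono divide_le_eq)
  have linS: "linear S" using S by (simp add: bounded_clinear_def bounded_linear.linear)
  show ?thesis
  proof (rule surj_if_approx_left_inverse[where Y = "\<lambda>x. (1 / K\<^sup>2) *\<^sub>R S x" and q = "sqrt q"])
    show "linear S" by (rule linS)
    show "linear (\<lambda>x. (1 / K\<^sup>2) *\<^sub>R S x)" using linear_compose_scale_right[OF linS] .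
    show "inj (\<lambda>x. (1 / K\<^sup>2) *\<^sub>R S x)"
    proof (rule injI)
      fix x y assume "(1 / K\<^sup>2) *\<^sub>R S x = (1 / K\<^sup>2) *\<^sub>R S y"
      then have "S (x - y) = 0" using K(1) by (simp add: bounded_clinear_simps[OF S])
      then show "x = y" using c(2)[of "x - y"] c(1) by (simp add: mult_le_0_iff)
    qed
    show "sqrt q < 1" using q by simp
    fix y
    have "(norm (y - (1 / K\<^sup>2) *\<^sub>R S (S y)))\<^sup>2
        = (norm y)\<^sup>2 - 2 * ((norm (S y))\<^sup>2 / K\<^sup>2) + (norm (S (S y)))\<^sup>2 / (K\<^sup>2)\<^sup>2"
      using sym[of y "S y"] norm_add_scaleR_sq[of y "- (1 / K\<^sup>2)" "S (S y)"]
      by (simp add: power2_norm_eq_inner[of "S y"] power_divide)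
    moreover have "(norm (S (S y)))\<^sup>2 / (K\<^sup>2)\<^sup>2 \<le> (norm (S y))\<^sup>2 / K\<^sup>2"
    proof -
      have "(norm (S (S y)))\<^sup>2 / (K\<^sup>2)\<^sup>2 \<le> (K * norm (S y))\<^sup>2 / (K\<^sup>2)\<^sup>2"
        using SK by (intro divide_right_mono power_mono) auto
      also have "\<dots> = (norm (S y))\<^sup>2 / K\<^sup>2"
        using K(1) by (simp add: power_mult_distrib power2_eq_square)
      finally show ?thesis .
    qed
    moreover have "(c * norm y)\<^sup>2 / K\<^sup>2 \<le> (norm (S y))\<^sup>2 / K\<^sup>2"
      using c by (intro divide_right_mono power_mono) auto
    moreover have "q * (norm y)\<^sup>2 = (norm y)\<^sup>2 - (c * norm y)\<^sup>2 / K\<^sup>2"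
      by (simp add: q_def power_mult_distrib left_diff_distrib)
    ultimately have "(norm (y - (1 / K\<^sup>2) *\<^sub>R S (S y)))\<^sup>2 \<le> q * (norm y)\<^sup>2"
      by linarith
    then have "norm (y - (1 / K\<^sup>2) *\<^sub>R S (S y)) \<le> sqrt (q * (norm y)\<^sup>2)"
      by (rule real_le_rsqrt)
    then show "norm (y - (1 / K\<^sup>2) *\<^sub>R S (S y)) \<le> sqrt q * norm y"
      by (simp add: real_sqrt_mult)
  qed
qed

context
  fixes P :: "'a::complex_inner \<Rightarrow> 'a"
  assumes P: "orthogonal_projection P"
begin

lemma projection_bounded_clinear: "bounded_clinear P"
  using P by (simp add: orthogonal_projection_def)

lemma projection_idem: "P (P x) = P x"
  using P unfolding orthogonal_projection_def by (metis comp_apply)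

lemma projection_cinner: "cinner (P x) y = cinner x (P y)"
  using P by (simp add: orthogonal_projection_def is_cadjoint_def)

lemma projection_cinner_self: "cinner (P x) x = complex_of_real ((norm (P x))\<^sup>2)"
  using projection_cinner[of "P x" x] by (simp add: projection_idem cinner_self)

lemma projection_norm_le: "norm (P x) \<le> norm x"
proof -
  have "(norm (P x))\<^sup>2 = inner (P x) x"
    using projection_cinner_self[of x] by (simp add: inner_eq_Re_cinner)
  also have "\<dots> \<le> norm (P x) * norm x" by (rule norm_cauchy_schwarz)
  finally show ?thesis
    by (cases "P x = 0") (simp_all add: power2_eq_square mult_le_cancel_left_pos)
qed

end

lemma bounded_clinear_scaleC: "bounded_clinear (\<lambda>x. c *\<^sub>C x)"
  by (simp add: bounded_clinear_def bounded_linear_scaleC scaleC_scaleC mult.commute)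

text \<open>Otherwise \<open>P Q - l\<close> is bounded below on the range of \<open>P\<close>. Then \<open>S = P Q P - l\<close> is bounded below
everywhere, as it acts as \<open>- l\<close> on the kernel of \<open>P\<close>. Being selfadjoint it has an inverse \<open>R\<close>, and
\<open>(P R P Q - 1) / l\<close> is an inverse of \<open>P Q - l\<close>.\<close>

lemma projection_product_approx_eigenvector:
  fixes P Q :: "'a::chilbert_space \<Rightarrow> 'a"
  assumes P: "orthogonal_projection P" and Q: "orthogonal_projection Q"
    and l: "l \<noteq> 0" "complex_of_real l \<in> op_spectrum (P \<circ> Q)" and \<delta>: "0 < \<delta>"
  obtains p where "P p = p" "norm p = 1" "norm (P (Q p) - complex_of_real l *\<^sub>C p) < \<delta>"
proof (rule ccontr)
  assume "\<not> thesis"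
  then have no: "\<delta> \<le> norm (P (Q p) - complex_of_real l *\<^sub>C p)" if "P p = p" "norm p = 1" for p
    using that \<open>\<And>p. \<lbrakk>P p = p; norm p = 1; norm (P (Q p) - complex_of_real l *\<^sub>C p) < \<delta>\<rbrakk> \<Longrightarrow> thesis\<close>
    by (meson not_le)
  note Pc = projection_bounded_clinear[OF P] and Qc = projection_bounded_clinear[OF Q]
  note simps = bounded_clinear_simps[OF Pc] bounded_clinear_simps[OF Qc]
  note idem = projection_idem[OF P]
  define c where "c = complex_of_real l"
  have c: "c \<noteq> 0" using l(1) by (simp add: c_def)
  have below: "\<delta> * norm p \<le> norm (P (Q p) - c *\<^sub>C p)" if p: "P p = p" for p
  proof (cases "p = 0")
    case False
    define p' where "p' = (1 / norm p) *\<^sub>R p"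
    have "\<delta> \<le> norm (P (Q p') - c *\<^sub>C p')"
      unfolding c_def using False p by (intro no) (simp_all add: p'_def simps)
    also have "P (Q p') - c *\<^sub>C p' = (1 / norm p) *\<^sub>R (P (Q p) - c *\<^sub>C p)"
      by (simp add: p'_def simps scaleR_scaleC scaleC_scaleC complex_vector.scale_right_diff_distrib mult.commute)
    finally show ?thesis using False by (simp add: pos_le_divide_eq)
  qed simp
  define S where "S x = P (Q (P x)) - c *\<^sub>C x" for x
  have S: "bounded_clinear S"
    unfolding S_def by (rule bounded_clinear_diff_scaleC[OF bounded_clinear_comp[OF Pc bounded_clinear_comp[OF Qc Pc]]])
  have sym: "inner (S x) y = inner x (S y)" for x y
  proof -
    have "cinner (S x) y = cinner x (S y)"
      unfolding S_def cinner_diff_left cinner_diff_right cinner_scaleC_left cinner_scaleC_right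
        projection_cinner[OF P] projection_cinner[OF Q] by (simp add: c_def)
    then show ?thesis by (simp only: inner_eq_Re_cinner)
  qed
  have "bounded_below S"
  proof -
    define k where "k = 1 / \<delta> + 2 / \<bar>l\<bar>"
    have k: "k > 0" using \<delta> l(1) by (simp add: k_def add_pos_nonneg)
    have "1 / k * norm x \<le> norm (S x)" for x
    proof -
      define p where "p = P x"
      have PS: "P (S x) = P (Q p) - c *\<^sub>C p" by (simp add: S_def p_def simps idem)
      then have "\<delta> * norm p \<le> norm (P (S x))" using below[of p] by (simp add: p_def idem)
      also have "\<dots> \<le> norm (S x)" by (rule projection_norm_le[OF P])
      finally have 1: "norm p \<le> norm (S x) / \<delta>" using \<delta> by (simp add: pos_le_divide_eq mult.commute)
      have "P (S x) - S x = c *\<^sub>C (x - p)"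
        unfolding PS by (simp add: S_def p_def complex_vector.scale_right_diff_distrib)
      then have "\<bar>l\<bar> * norm (x - p) = norm (P (S x) - S x)" by (simp add: norm_scaleC c_def)
      also have "\<dots> \<le> 2 * norm (S x)"
        using norm_triangle_ineq4[of "P (S x)" "S x"] projection_norm_le[OF P, of "S x"] by linarith
      finally have "norm (x - p) \<le> 2 * norm (S x) / \<bar>l\<bar>"
        using l(1) by (simp add: pos_le_divide_eq mult.commute)
      moreover have "norm x \<le> norm p + norm (x - p)" using norm_triangle_ineq[of p "x - p"] by simp
      ultimately have "norm x \<le> norm (S x) / \<delta> + 2 * norm (S x) / \<bar>l\<bar>" using 1 by linarith
      also have "\<dots> = k * norm (S x)" by (simp add: k_def distrib_right)
      finally show ?thesis using k by (simp add: pos_divide_le_eq mult.commute)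
    qed
    then show ?thesis using k unfolding bounded_below_def by (intro exI[of _ "1 / k"]) simp
  qed
  then have "invertible_operator S"
    using selfadjoint_bounded_below_surj[OF S sym] by (intro invertible_if_bounded_below_surj[OF S])
  then obtain R where R: "bounded_clinear R" "S \<circ> R = id" "R \<circ> S = id"
    unfolding invertible_operator_def by blast
  have SR: "S (R y) = y" "R (S y) = y" for y using fun_cong[OF R(2), of y] fun_cong[OF R(3), of y] by simp_all
  note simpsR = simps bounded_clinear_simps[OF R(1)]
  define Y where "Y v = P (R (P (Q ((1 / c) *\<^sub>C v)))) - (1 / c) *\<^sub>C v" for v
  have Y: "bounded_clinear Y"
    unfolding Y_def
    by (rule bounded_clinear_diff_scaleC[OF bounded_clinear_comp[OF Pc bounded_clinear_comp[OF R(1)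
        bounded_clinear_comp[OF Pc bounded_clinear_comp[OF Qc bounded_clinear_scaleC]]]]])
  have "P (Q (Y v)) - c *\<^sub>C Y v = v" for v
  proof -
    define g where "g = R (P (Q ((1 / c) *\<^sub>C v)))"
    have "P (S g) = P (Q ((1 / c) *\<^sub>C v))" by (simp add: g_def SR idem)
    then have "P (Q (P g)) = P (Q ((1 / c) *\<^sub>C v)) + c *\<^sub>C P g"
      by (simp add: S_def simps idem diff_eq_eq)
    moreover have "c *\<^sub>C ((1 / c) *\<^sub>C v) = v" using c by (simp add: scaleC_scaleC)
    ultimately show ?thesis
      by (simp add: Y_def g_def[symmetric] bounded_clinear_simps(2)[OF Pc] bounded_clinear_simps(2)[OF Qc]
          complex_vector.scale_right_diff_distrib)
  qed
  moreover have "Y (P (Q v) - c *\<^sub>C v) = v" for v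
  proof -
    define w where "w = (1 / c) *\<^sub>C v"
    have v: "v = c *\<^sub>C w" using c by (simp add: w_def scaleC_scaleC)
    have cw: "(1 / c) *\<^sub>C (c *\<^sub>C x) = x" for x :: 'a using c by (simp add: scaleC_scaleC)
    have "P (Q ((1 / c) *\<^sub>C (P (Q v) - c *\<^sub>C v))) = S (P (Q w))"
      using c by (simp add: v simps cw idem S_def complex_vector.scale_right_diff_distrib)
    with c show ?thesis
      by (simp add: Y_def SR idem) (simp add: v simps cw complex_vector.scale_right_diff_distrib)
  qed
  ultimately have "invertible_operator (\<lambda>x. (P \<circ> Q) x - c *\<^sub>C x)"
    unfolding invertible_operator_def using Y by (intro exI[of _ Y]) (auto simp: fun_eq_iff)
  then show False using l(2) by (simp add: op_spectrum_def c_def)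
qed

text \<open>A unit vector in the kernel of \<open>P\<close> gives this value; the kernel is nonzero since \<open>P\<close> is not the
identity.\<close>

lemma zero_in_numerical_range_projection_product:
  assumes P: "orthogonal_projection P" "\<not> scalar_operator P"
  shows "0 \<in> numerical_range (P \<circ> Q)"
proof -
  note simps = bounded_clinear_simps[OF projection_bounded_clinear[OF P(1)]]
  have "P \<noteq> (\<lambda>x. 1 *\<^sub>C x)" using P(2) unfolding scalar_operator_def by blast
  then obtain y where y: "P y \<noteq> y" by auto
  define x where "x = (1 / norm (y - P y)) *\<^sub>R (y - P y)"
  have "norm x = 1" using y by (simp add: x_def)
  moreover have "P x = 0" by (simp add: x_def simps projection_idem[OF P(1)])
  then have "cinner (P (Q x)) x = 0" by (simp add: projection_cinner[OF P(1)])
  ultimately show ?thesis unfolding numerical_range_def by force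
qed

section \<open>Equality for projections\<close>

text \<open>If \<open>P Q p = l p\<close> held exactly, the span of \<open>p\<close> and \<open>Q p\<close> would be invariant under the real part of
\<open>e P Q\<close>, with \<open>x = (2 t - cnj e l) p + cnj e Q p\<close> as eigenvector for the eigenvalue \<open>t\<close>. For an
approximate eigenvector \<open>p\<close> the two sides of the hypothesis at this \<open>x\<close> differ from \<open>t X\<close> and \<open>h X\<close>,
where \<open>X > 0\<close> is the limit of \<open>(norm x)\<^sup>2\<close>, by a multiple of \<open>\<delta>\<close>.\<close>

lemma projection_product_quadratic_form_ge:
  fixes P Q :: "'a::complex_inner \<Rightarrow> 'a"
  assumes P: "orthogonal_projection P" and Q: "orthogonal_projection Q" and e: "cmod e = 1"
    and l: "0 \<le> l" "l \<le> 1" and t: "t = disk_support e l" "0 < t" and h: "0 \<le> h"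
    and le: "\<And>x. Re (e * cinner (P (Q x)) x) \<le> h * (norm x)\<^sup>2"
    and approx: "\<And>\<delta>. 0 < \<delta> \<Longrightarrow> \<exists>p. P p = p \<and> norm p = 1 \<and> norm (P (Q p) - complex_of_real l *\<^sub>C p) < \<delta>"
  shows "t \<le> h"
proof -
  define c where "c = Re e"
  define a where "a = complex_of_real (2 * t) - cnj e * complex_of_real l"
  define g where "g = 2 * t * (2 * t * c - l + 1)"
  define X where "X = 4 * t\<^sup>2 + l - l\<^sup>2"
  define C where "C = \<bar>g\<bar> + cmod a + 1 + h * \<bar>1 + 2 * (2 * t * c - l)\<bar>"
  note quad = disk_support_quadratic[OF e l t(1)]
  have ee: "e * cnj e = 1" "cnj e * e = 1" using e by (simp_all add: complex_norm_square[symmetric] mult.commute)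
  have Re_ae: "Re (a * e) = 2 * t * c - l"
  proof -
    have "a * e = complex_of_real (2 * t) * e - (cnj e * e) * complex_of_real l"
      by (simp add: a_def left_diff_distrib)
    then have "a * e = complex_of_real (2 * t) * e - complex_of_real l" by (simp only: ee mult_1_left)
    then show ?thesis by (simp add: c_def)
  qed
  have cnj_a: "cnj a + e * complex_of_real l = complex_of_real (2 * t)" by (simp add: a_def)
  have norm_a: "(cmod a)\<^sup>2 = 4 * t\<^sup>2 - 4 * t * l * c + l\<^sup>2"
  proof -
    have "(cmod e)\<^sup>2 = (Re e)\<^sup>2 + (Im e)\<^sup>2" by (rule cmod_power2)
    then have ei: "(Im e)\<^sup>2 = 1 - c\<^sup>2" using e by (simp add: c_def)
    have "(cmod a)\<^sup>2 = (2 * t - c * l)\<^sup>2 + (Im e)\<^sup>2 * l\<^sup>2"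
      by (simp add: cmod_power2 a_def c_def power_mult_distrib)
    then show ?thesis unfolding ei by (simp add: power2_eq_square algebra_simps)
  qed
  \<comment> \<open>the eigenvalue equation for \<open>x\<close>, paired with \<open>x\<close>, in the limit \<open>\<delta> = 0\<close>\<close>
  have gl: "g * l = t * X"
  proof -
    have "l\<^sup>2 = l - 4 * t\<^sup>2 + 4 * t * l * c" using quad by (simp add: c_def)
    then have "2 * t * l\<^sup>2 = 2 * t * (l - 4 * t\<^sup>2 + 4 * t * l * c)" "t * l\<^sup>2 = t * (l - 4 * t\<^sup>2 + 4 * t * l * c)"
      by simp_all
    then show ?thesis unfolding g_def X_def by (simp add: power2_eq_square algebra_simps)
  qed
  have Xa: "(cmod a)\<^sup>2 + l * (1 + 2 * (2 * t * c - l)) = X"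
    unfolding norm_a X_def by (simp add: power2_eq_square algebra_simps)
  have Xpos: "0 < X"
  proof -
    have "l\<^sup>2 \<le> l" using l by (simp add: power2_eq_square mult_left_le)
    moreover have "0 < 4 * t\<^sup>2" using t(2) by simp
    ultimately show ?thesis unfolding X_def by linarith
  qed
  have C: "0 < C" using h by (simp add: C_def add_nonneg_pos add_pos_nonneg)
  have "(t - h) * X \<le> C * \<delta>" if \<delta>: "0 < \<delta>" for \<delta>
  proof -
    obtain p where p: "P p = p" "norm p = 1" "norm (P (Q p) - complex_of_real l *\<^sub>C p) < \<delta>"
      using approx[OF \<delta>] by blast
    define d where "d = P (Q p) - complex_of_real l *\<^sub>C p"
    have d: "norm d < \<delta>" and PQp: "P (Q p) = complex_of_real l *\<^sub>C p + d" using p by (simp_all add: d_def)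
    define \<mu> where "\<mu> = (norm (Q p))\<^sup>2"
    define x where "x = a *\<^sub>C p + cnj e *\<^sub>C Q p"
    note simps = bounded_clinear_simps[OF projection_bounded_clinear[OF P]]
      bounded_clinear_simps[OF projection_bounded_clinear[OF Q]]
    have Qpp: "cinner (Q p) p = complex_of_real \<mu>"
      by (simp add: \<mu>_def projection_cinner_self[OF Q])
    then have pQp: "cinner p (Q p) = complex_of_real \<mu>" by (metis cinner_commute complex_cnj_complex_of_real)
    have PQpp: "cinner (P (Q p)) p = complex_of_real \<mu>" by (simp add: projection_cinner[OF P] p(1) Qpp)
    then have "complex_of_real \<mu> = complex_of_real l + cinner d p"
      unfolding PQp by (simp add: cinner_simps cinner_self p(2))
    then have "cmod (complex_of_real (\<mu> - l)) = cmod (cinner d p)" by simp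
    then have \<mu>: "\<bar>\<mu> - l\<bar> \<le> \<delta>"
      using cmod_cinner_le[of d p] d p(2) unfolding norm_of_real by simp
    have PQx: "P (Q x) = (a + cnj e) *\<^sub>C P (Q p)"
      by (simp add: x_def simps projection_idem[OF Q] scaleC_add_left)
    have "e * cinner (P (Q x)) x = e * (a + cnj e) * (cnj a * complex_of_real \<mu> + e * cinner (P (Q p)) (Q p))"
      unfolding PQx cinner_scaleC_left by (simp add: x_def cinner_simps PQpp)
    also have "cinner (P (Q p)) (Q p) = complex_of_real l * complex_of_real \<mu> + cinner d (Q p)"
      unfolding PQp by (simp add: cinner_simps pQp)
    also have "e * (a + cnj e) * (cnj a * complex_of_real \<mu> + e * (complex_of_real l * complex_of_real \<mu> + cinner d (Q p)))
      = (a * e + 1) * (cnj a + e * complex_of_real l) * complex_of_real \<mu> + e * (a + cnj e) * e * cinner d (Q p)"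
      using ee by (simp add: algebra_simps)
    finally have val: "e * cinner (P (Q x)) x
      = complex_of_real (2 * t * \<mu>) * (a * e + 1) + e * (a + cnj e) * e * cinner d (Q p)"
      unfolding cnj_a by (simp add: mult_ac)
    have "cmod (e * (a + cnj e) * e * cinner d (Q p)) = cmod (a + cnj e) * cmod (cinner d (Q p))"
      using e by (simp add: norm_mult)
    also have "\<dots> \<le> (cmod a + 1) * (norm d * norm (Q p))"
      using norm_triangle_ineq[of a "cnj e"] e by (intro mult_mono cmod_cinner_le) auto
    also have "\<dots> \<le> (cmod a + 1) * (\<delta> * 1)"
      using projection_norm_le[OF Q, of p] p(2) d \<delta> by (intro mult_left_mono mult_mono) auto
    finally have err: "- ((cmod a + 1) * \<delta>) \<le> Re (e * (a + cnj e) * e * cinner d (Q p))"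
      using abs_Re_le_cmod[of "e * (a + cnj e) * e * cinner d (Q p)"] by linarith
    have "Re (e * cinner (P (Q x)) x) = g * \<mu> + Re (e * (a + cnj e) * e * cinner d (Q p))"
    proof -
      have "Re (complex_of_real r * w) = r * Re w" for r w by simp
      then show ?thesis unfolding val plus_complex.sel(1) by (simp only: plus_complex.sel(1) Re_ae g_def one_complex.sel(1) mult_ac)
    qed
    then have lower: "g * \<mu> - (cmod a + 1) * \<delta> \<le> h * (norm x)\<^sup>2" using le[of x] err by linarith
    have "complex_of_real ((norm x)\<^sup>2) = a * cnj a + (1 + (a * e + cnj (a * e))) * complex_of_real \<mu>"
    proof -
      have QQ: "cinner (Q p) (Q p) = complex_of_real \<mu>" and pp: "cinner p p = 1"
        by (simp_all add: cinner_self \<mu>_def p(2))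
      show ?thesis
        unfolding cinner_self[symmetric] x_def cinner_add_left cinner_add_right cinner_scaleC_left
          cinner_scaleC_right QQ pp Qpp pQp
        by (simp add: ee algebra_simps)
    qed
    also have "\<dots> = complex_of_real ((cmod a)\<^sup>2 + \<mu> * (1 + 2 * (2 * t * c - l)))"
      unfolding complex_add_cnj Re_ae complex_norm_square[symmetric] by simp
    finally have norm_x: "(norm x)\<^sup>2 = (cmod a)\<^sup>2 + \<mu> * (1 + 2 * (2 * t * c - l))"
      by (simp only: of_real_eq_iff)
    have "g * l - \<bar>g\<bar> * \<delta> \<le> g * \<mu>"
    proof -
      have "g * (l - \<mu>) \<le> \<bar>g\<bar> * \<bar>\<mu> - l\<bar>" by (metis abs_ge_self abs_minus_commute abs_mult)
      also have "\<dots> \<le> \<bar>g\<bar> * \<delta>" using \<mu> by (intro mult_left_mono) auto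
      finally show ?thesis by (simp add: right_diff_distrib)
    qed
    moreover have "(norm x)\<^sup>2 \<le> X + \<delta> * \<bar>1 + 2 * (2 * t * c - l)\<bar>"
    proof -
      have "(\<mu> - l) * (1 + 2 * (2 * t * c - l)) \<le> \<bar>\<mu> - l\<bar> * \<bar>1 + 2 * (2 * t * c - l)\<bar>"
        by (metis abs_ge_self abs_mult)
      also have "\<dots> \<le> \<delta> * \<bar>1 + 2 * (2 * t * c - l)\<bar>" using \<mu> by (intro mult_right_mono) auto
      finally show ?thesis unfolding norm_x Xa[symmetric] by (simp add: left_diff_distrib)
    qed
    then have "h * (norm x)\<^sup>2 \<le> h * (X + \<delta> * \<bar>1 + 2 * (2 * t * c - l)\<bar>)" using h by (rule mult_left_mono)
    ultimately have "t * X - \<bar>g\<bar> * \<delta> - (cmod a + 1) * \<delta> \<le> h * (X + \<delta> * \<bar>1 + 2 * (2 * t * c - l)\<bar>)"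
      using lower gl by linarith
    then show ?thesis by (simp add: C_def algebra_simps)
  qed
  note bound = this
  show ?thesis
  proof (rule ccontr)
    assume "\<not> ?thesis"
    then have pos: "0 < (t - h) * X" using Xpos by simp
    from bound[of "(t - h) * X / (2 * C)"] pos C show False by (simp add: mult.commute)
  qed
qed

text \<open>By convexity it is enough to compare supporting lines. A line that separates a point of the disk
from \<open>0\<close> has \<open>disk_support e l > 0\<close>, which excludes \<open>l = 0\<close>.\<close>

lemma elliptical_disk_subset_closure_numerical_range:
  fixes P Q :: "'a::chilbert_space \<Rightarrow> 'a"
  assumes P: "orthogonal_projection P" "\<not> scalar_operator P" and Q: "orthogonal_projection Q"
    and l: "complex_of_real l \<in> op_spectrum (P \<circ> Q)"
  shows "elliptical_disk l \<subseteq> closure (numerical_range (P \<circ> Q))"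
proof (rule ccontr)
  assume "\<not> ?thesis"
  then obtain z where z: "z \<in> elliptical_disk l" "z \<notin> closure (numerical_range (P \<circ> Q))" by blast
  note l01 = elliptical_disk_bounds[OF z(1)]
  have PQ: "bounded_clinear (P \<circ> Q)"
    using bounded_clinear_comp[OF projection_bounded_clinear[OF P(1)] projection_bounded_clinear[OF Q]]
    by (simp add: o_def)
  have zero: "0 \<in> closure (numerical_range (P \<circ> Q))"
    using zero_in_numerical_range_projection_product[OF P] closure_subset by blast
  obtain e h where e: "cmod e = 1" and gt: "h < Re (e * z)"
    and lt: "\<And>w. w \<in> closure (numerical_range (P \<circ> Q)) \<Longrightarrow> Re (e * w) < h"
    using separate_from_closed_convex[OF convex_closure[OF Toeplitz_Hausdorff[OF PQ]] closed_closure zero z(2)]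
    by blast
  have h: "0 < h" using lt[OF zero] by simp
  have supp: "h < disk_support e l" using gt Re_le_disk_support[OF e z(1)] by simp
  then have "l \<noteq> 0" using h by (auto simp: disk_support_def)
  have "disk_support e l \<le> h"
  proof (rule projection_product_quadratic_form_ge[OF P(1) Q e l01 refl])
    show "0 < disk_support e l" "0 \<le> h" using h supp by simp_all
    show "Re (e * cinner (P (Q x)) x) \<le> h * (norm x)\<^sup>2" for x
    proof (cases "x = 0")
      case False
      define y where "y = (1 / norm x) *\<^sub>R x"
      have "norm y = 1" using False by (simp add: y_def)
      then have "cinner (P (Q y)) y \<in> closure (numerical_range (P \<circ> Q))"
        by (intro subsetD[OF closure_subset]) (auto simp: numerical_range_def)
      then have "Re (e * cinner (P (Q y)) y) \<le> h" using lt by fastforce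
      moreover have "cinner (P (Q x)) x = complex_of_real ((norm x)\<^sup>2) * cinner (P (Q y)) y"
      proof -
        have x: "x = complex_of_real (norm x) *\<^sub>C y" using False by (simp add: y_def flip: scaleR_scaleC)
        have "cinner ((P \<circ> Q) (r *\<^sub>C y)) (r *\<^sub>C y) = r * cnj r * cinner (P (Q y)) y" for r
          unfolding bounded_clinear_simps(5)[OF PQ] by (simp add: cinner_simps)
        from this[of "complex_of_real (norm x)"] show ?thesis
          unfolding x[symmetric] by (simp add: power2_eq_square)
      qed
      then have "Re (e * cinner (P (Q x)) x) = (norm x)\<^sup>2 * Re (e * cinner (P (Q y)) y)"
        by (simp add: algebra_simps)
      ultimately show ?thesis by (simp only: mult.commute[of h] mult_left_mono zero_le_power2)
    qed (simp add: bounded_clinear_simps[OF projection_bounded_clinear[OF P(1)]])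
    show "\<exists>p. P p = p \<and> norm p = 1 \<and> norm (P (Q p) - complex_of_real l *\<^sub>C p) < \<delta>" if "0 < \<delta>" for \<delta>
      using projection_product_approx_eigenvector[OF P(1) Q \<open>l \<noteq> 0\<close> l that] by blast
  qed
  with supp show False by simp
qed

theorem theorem4p2:
  fixes A B :: "'a::chilbert_space \<Rightarrow> 'a"
  assumes infinite_dim: "\<And>S :: 'a set. finite S \<Longrightarrow> cspan S \<noteq> UNIV"
    and A: "positive_semidefinite A" "contraction A" "\<not> scalar_operator A"
    and B: "positive_semidefinite B" "contraction B" "\<not> scalar_operator B"
  shows "closure (numerical_range (A \<circ> B)) \<subseteq>
           closure (convex hull
             (\<Union>l\<in>{l. complex_of_real l \<in> op_spectrum (A \<circ> B)}. elliptical_disk l))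
    \<and> (countable (op_spectrum (A \<circ> B)) \<longrightarrow>
         numerical_range (A \<circ> B) \<subseteq>
           convex hull
             (\<Union>l\<in>{l. complex_of_real l \<in> op_spectrum (A \<circ> B)}. elliptical_disk l))
    \<and> (orthogonal_projection A \<and> orthogonal_projection B \<longrightarrow>
         closure (numerical_range (A \<circ> B)) =
           closure (convex hull
             (\<Union>l\<in>{l. complex_of_real l \<in> op_spectrum (A \<circ> B)}. elliptical_disk l)))"
proof -
  let ?U = "\<Union>l\<in>{l. complex_of_real l \<in> op_spectrum (A \<circ> B)}. elliptical_disk l"
  have AB: "positive_contraction A" "positive_contraction B"
    using A B by (simp_all add: positive_contraction_def)
  note subset = numerical_range_product_subset(1)[OF AB]
  have "closure (convex hull ?U) \<subseteq> closure (numerical_range (A \<circ> B))"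
    if proj: "orthogonal_projection A" "orthogonal_projection B"
  proof -
    have "bounded_clinear (A \<circ> B)"
      using bounded_clinear_comp[OF projection_bounded_clinear[OF proj(1)] projection_bounded_clinear[OF proj(2)]]
      by (simp add: o_def)
    then have "convex (closure (numerical_range (A \<circ> B)))" by (intro convex_closure Toeplitz_Hausdorff)
    moreover have "?U \<subseteq> closure (numerical_range (A \<circ> B))"
      using elliptical_disk_subset_closure_numerical_range[OF proj(1) A(3) proj(2)] by blast
    ultimately show ?thesis by (intro closure_minimal hull_minimal) auto
  qed
  with subset closure_mono[OF subset] show ?thesis by (simp add: subset_antisym)
qed

end
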